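(* For every $\eta\in\mathbb R$ there exists an irrational number $\alpha$ of bounded type such that $\{D_N(\alpha)\}_{N\ge1}$ is exponentially tilted with tilt parameter $\eta$, i.e. $$\lim_{n\to\infty}\frac{\#\{1\le N\le n:D_N(\alpha)=\xi_1\}}{\#\{1\le N\le n:D_N(\alpha)=\xi_2\}}=e^{\eta(\xi_1-\xi_2)}\qquad\text{for all }\xi_1,\xi_2\in\tfrac12\mathbb Z .$$
   Context: $\{x\}\in[0,1)$ denotes the fractional part of $x$. For irrational $\alpha$, $D_N(\alpha):=\#\{0\le j\le N-1:\{j\alpha\}\in[0,\tfrac12)\}-\tfrac12N\in\tfrac12\mathbb Z$. An irrational number is of bounded type if the partial quotients of its regular continued fraction expansion are bounded. *)

theory Defs
  imports Complex_Main
begin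

text \<open>
  Complete quotients and partial quotients of the regular continued fraction expansion
  \<open>x = [a\<^sub>0; a\<^sub>1, a\<^sub>2, \<dots>]\<close>. For rational \<open>x\<close> the expansion terminates, and the values past its end
  (coming from \<open>1 / 0 = 0\<close>) carry no meaning; only irrational \<open>x\<close> are of interest.
\<close>

primrec complete_quotient :: "real \<Rightarrow> nat \<Rightarrow> real" where
  "complete_quotient x 0 = x"
| "complete_quotient x (Suc n) = 1 / frac (complete_quotient x n)"

definition partial_quotient :: "real \<Rightarrow> nat \<Rightarrow> int" where
  "partial_quotient x n = \<lfloor>complete_quotient x n\<rfloor>"

definition bounded_type :: "real \<Rightarrow> bool" where
  "bounded_type x \<longleftrightarrow> x \<notin> \<rat> \<and> (\<exists>K. \<forall>n. \<bar>partial_quotient x n\<bar> \<le> K)"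

definition discrepancy :: "real \<Rightarrow> nat \<Rightarrow> real" where
  "discrepancy \<alpha> N =
     real (card {j::nat. j < N \<and> frac (real j * \<alpha>) \<in> {0..<1/2}}) - real N / 2"

definition half_ints :: "real set" where
  "half_ints = range (\<lambda>k::int. of_int k / 2)"

definition visits :: "(nat \<Rightarrow> real) \<Rightarrow> real \<Rightarrow> nat \<Rightarrow> nat" where
  "visits a \<xi> n = card {N \<in> {1..n}. a N = \<xi>}"

text \<open>
  The sequence is indexed by \<open>N \<ge> 1\<close>; the value \<open>a 0\<close> is ignored. The limit is positive, so
  convergence forces the denominators to be eventually nonzero, despite \<open>x / 0 = 0\<close>.
\<close>

definition exponentially_tilted :: "(nat \<Rightarrow> real) \<Rightarrow> real \<Rightarrow> bool" where
  "exponentially_tilted a \<eta> \<longleftrightarrow>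
     (\<forall>\<xi>\<^sub>1 \<in> half_ints. \<forall>\<xi>\<^sub>2 \<in> half_ints.
        (\<lambda>n. real (visits a \<xi>\<^sub>1 n) / real (visits a \<xi>\<^sub>2 n)) \<longlonglongrightarrow> exp (\<eta> * (\<xi>\<^sub>1 - \<xi>\<^sub>2)))"

end

theory Submission
  imports Defs
begin

text \<open>
  Put \<open>\<beta> = 2 \<alpha>\<close>; then \<open>2 D\<^sub>N - 1\<close> is the walk \<open>S (N - 1)\<close> with steps \<open>(-1)\<^bsup>\<lfloor>j \<beta>\<rfloor>\<^esup>\<close>.
  If \<open>p / q\<close> is a good approximation of \<open>\<beta>\<close>, then \<open>S (q + N) = S q \<plusminus> S N\<close>, the sign being the
  parity of \<open>p\<close>, and \<open>S\<close> is symmetric or antisymmetric on \<open>[0, q)\<close>. Hence the visit counts of the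
  walk up to time \<open>q\<close> obey a linear recursion with nonnegative coefficients, in which all shifts
  can be chosen to point to the right or to the left, according to the next partial quotients.

  Weight a visit at \<open>d\<close> by \<open>z\<^bsup>d\<^esup>\<close> with \<open>z = exp (- \<eta> / 2)\<close>; the claim becomes that the weighted visit
  counts are asymptotically flat. The direction of the shifts is chosen so as to keep the mean of
  the weighted counts bounded; their variance then grows at most linearly in the level of the
  recursion. As each step of the recursion contains a convolution with \<open>(1, z)\<close>, the weighted
  counts are mixtures of binomial distributions with many trials, so they are flat up to an
  exponentially small error, and the variance bound shows that the error is negligible near \<open>0\<close>.
\<close>

section \<open>Almost flat weights\<close>

text \<open>The directions are decided before there is a walk: the functionals are formal objects
  generated by the recursion, they determine the sequence \<open>fl\<close>, and \<open>fl\<close>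
  fixes the partial quotients and so \<beta>. Only then are the functionals recognised as visit
  counts.

  An odd numerator makes the walk repeat with reversed sign, which would reflect the counts and
  invert the tilt. Combined with the antisymmetry of the block, the reflection becomes a reversal of
  time, under which counts are merely shifted.

  The mean has to stay bounded because flatness is propagated across a window whose radius is a
  small multiple of the level; a drift linear in the level could carry the mass out of it.

  A relative error alone cannot describe flatness, since ratios of binomial weights degenerate in
  the tails. The additive error \<open>x\<close> covers the tails and simply adds up under mixtures.

  A general time n cuts a block in two, and the cut piece has to be treated separately: it carries
  at most a fixed fraction of the mass, so its error still decays exponentially from level to
  level.\<close>

definition nearly_flat :: "real \<Rightarrow> (int \<Rightarrow> real) \<Rightarrow> real \<Rightarrow> bool" where
  "nearly_flat \<epsilon> f x \<longleftrightarrow>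
     (\<forall>d. f (d + 1) \<le> (1 + \<epsilon>) * f d + x \<and> f d \<le> (1 + \<epsilon>) * f (d + 1) + x)"

lemma nearly_flat_mono: "nearly_flat \<epsilon> f x \<Longrightarrow> x \<le> x' \<Longrightarrow> nearly_flat \<epsilon> f x'"
  unfolding nearly_flat_def by (meson add_left_mono order_trans)

lemma nearly_flat_add:
  assumes "nearly_flat \<epsilon> f x" "nearly_flat \<epsilon> g x'"
  shows "nearly_flat \<epsilon> (\<lambda>d. f d + g d) (x + x')"
  unfolding nearly_flat_def
proof
  fix d
  show "f (d+1) + g (d+1) \<le> (1 + \<epsilon>) * (f d + g d) + (x + x') \<and>
        f d + g d \<le> (1 + \<epsilon>) * (f (d+1) + g (d+1)) + (x + x')"
    using assms[unfolded nearly_flat_def, rule_format, of d] by (simp add: distrib_left)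
qed

lemma nearly_flat_scale_shift:
  assumes "nearly_flat \<epsilon> f x" "0 \<le> c"
  shows "nearly_flat \<epsilon> (\<lambda>d. c * f (d - s)) (c * x)"
  unfolding nearly_flat_def
proof
  fix d
  have e: "d + 1 - s = (d - s) + 1" by simp
  have "c * f (d - s + 1) \<le> c * ((1 + \<epsilon>) * f (d - s) + x)"
       "c * f (d - s) \<le> c * ((1 + \<epsilon>) * f (d - s + 1) + x)"
    using assms(1)[unfolded nearly_flat_def, rule_format, of "d - s"] assms(2)
    by (auto intro: mult_left_mono)
  then show "c * f (d + 1 - s) \<le> (1 + \<epsilon>) * (c * f (d - s)) + c * x \<and>
        c * f (d - s) \<le> (1 + \<epsilon>) * (c * f (d + 1 - s)) + c * x"
    unfolding e by (simp add: algebra_simps)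
qed

section \<open>Binomial weights and their Chernoff bounds\<close>

definition binom_weight :: "real \<Rightarrow> nat \<Rightarrow> int \<Rightarrow> real" where
  "binom_weight z m j = (if 0 \<le> j then real (m choose nat j) * z ^ nat j else 0)"

lemma binom_weight_nonneg: "0 \<le> z \<Longrightarrow> 0 \<le> binom_weight z m j"
  by (simp add: binom_weight_def)

lemma binom_weight_Suc:
  "binom_weight z (Suc m) j = binom_weight z m j + z * binom_weight z m (j - 1)"
proof (cases "0 < j")
  case True
  then obtain i where i: "j = int (Suc i)" by (metis gr0_implies_Suc zero_less_imp_eq_int)
  show ?thesis by (simp add: binom_weight_def i nat_add_distrib algebra_simps)
next
  case False
  then show ?thesis by (cases "j = 0") (auto simp: binom_weight_def)
qed

lemma binomial_term_le:
  fixes u v z :: real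
  assumes "0 \<le> u" "0 \<le> v" "0 \<le> z" "i \<le> m"
  shows "real (m choose i) * z ^ i * (u ^ (m - i) * v ^ i) \<le> (u + v * z) ^ m"
proof -
  have "(v * z + u) ^ m = (\<Sum>k\<le>m. of_nat (m choose k) * (v * z) ^ k * u ^ (m - k))"
    by (rule binomial_ring)
  also have "\<dots> \<ge> of_nat (m choose i) * (v * z) ^ i * u ^ (m - i)"
    using assms by (intro member_le_sum) auto
  finally show ?thesis by (simp add: power_mult_distrib mult_ac add.commute)
qed

text \<open>Chernoff bound: in the expansion of the right-hand power, term i carries the extra
  factor exp (h * (m - i - c * i)), which \<open>far\<close> bounds below by exp (- h). The
  \<open>+ 1\<close> in \<open>far\<close> is there because the ratio of consecutive weights
  produces it.\<close>

lemma binomial_tail: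
  fixes z h c :: real
  assumes z: "0 < z" and h: "0 < h" and i: "i \<le> m" and far: "c * real i \<le> real (m - i) + 1"
  shows "real (m choose i) * z ^ i \<le> exp h * (exp h + exp (- (h * c)) * z) ^ m"
proof -
  have "real (m choose i) * z ^ i * (exp h ^ (m - i) * exp (- (h * c)) ^ i)
      \<le> (exp h + exp (- (h * c)) * z) ^ m"
    using z i by (intro binomial_term_le) auto
  moreover have "exp h ^ (m - i) * exp (- (h * c)) ^ i = exp (h * (real (m - i) - c * real i))"
    by (simp add: exp_of_nat_mult [symmetric] exp_add [symmetric] algebra_simps)
  moreover have "exp (- h) \<le> exp (h * (real (m - i) - c * real i))"
    using mult_left_mono[OF far, of h] h by (simp add: algebra_simps)
  ultimately have "real (m choose i) * z ^ i * exp (- h) \<le> (exp h + exp (- (h * c)) * z) ^ m"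
    using z by (smt (verit) mult_left_mono mult_nonneg_nonneg of_nat_0_le_iff zero_le_power)
  then show ?thesis by (simp add: exp_minus field_simps)
qed

lemma binomial_tail':
  fixes z h c :: real
  assumes z: "0 < z" and h: "0 < h" and i: "i \<le> m" and far: "c * real (m - i) \<le> real i + 1"
  shows "real (m choose i) * z ^ i \<le> exp h * (exp (- (h * c)) + exp h * z) ^ m"
proof -
  have "real (m choose i) * z ^ i * (exp (- (h * c)) ^ (m - i) * exp h ^ i)
      \<le> (exp (- (h * c)) + exp h * z) ^ m"
    using z i by (intro binomial_term_le) auto
  moreover have "exp (- (h * c)) ^ (m - i) * exp h ^ i = exp (h * (real i - c * real (m - i)))"
    by (simp add: exp_of_nat_mult [symmetric] exp_add [symmetric] algebra_simps)
  moreover have "exp (- h) \<le> exp (h * (real i - c * real (m - i)))"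
    using mult_left_mono[OF far, of h] h by (simp add: algebra_simps)
  ultimately have "real (m choose i) * z ^ i * exp (- h) \<le> (exp (- (h * c)) + exp h * z) ^ m"
    using z by (smt (verit) mult_left_mono mult_nonneg_nonneg of_nat_0_le_iff zero_le_power)
  then show ?thesis by (simp add: exp_minus field_simps)
qed

text \<open>Both sides agree at h = 0, so the sign of the derivative decides. In the two
  applications the derivative is -\<epsilon> and -\<epsilon> * z: the margin \<epsilon> in the ratio
  is what pushes the tail base below 1 + z.\<close>

lemma chernoff_base:
  fixes a b c d :: real
  assumes "a * c + b * d < 0"
  shows "\<exists>h0>0. \<forall>h. 0 < h \<and> h < h0 \<longrightarrow> a * exp (c * h) + b * exp (d * h) < a + b"
proof -
  have "((\<lambda>h. a * exp (c * h) + b * exp (d * h)) has_real_derivative (a * c + b * d)) (at 0)"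
    by (auto intro!: derivative_eq_intros)
  from DERIV_neg_dec_right[OF this assms] show ?thesis by auto
qed

lemma binom_weight_step:
  assumes "i < m"
  shows "binom_weight z m (int i + 1) * real (i + 1) = binom_weight z m (int i) * (z * real (m - i))"
proof -
  have "real (m choose Suc i) * real (Suc i) = real (m choose i) * real (m - i)"
    by (metis binomial_absorb_comp binomial_absorption mult.commute of_nat_mult)
  moreover have "nat (int i + 1) = Suc i" by simp
  ultimately show ?thesis by (simp add: binom_weight_def algebra_simps del: of_nat_Suc)
qed

text \<open>Consecutive weights have ratio z * (m - i) / (i + 1). Where the ratio violates the
  factor 1 + \<epsilon>, the index i is away from the mean m * z / (1 + z) by a fixed proportion,
  and the weight itself is exponentially small compared to the mass (1 + z)^m.\<close>

lemma binom_weight_nearly_flat: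
  assumes z: "0 < z" and \<epsilon>: "0 < \<epsilon>"
  shows "\<exists>\<tau> C. 0 < \<tau> \<and> \<tau> < 1 + z \<and> 0 < C \<and> (\<forall>m. nearly_flat \<epsilon> (binom_weight z m) (C * \<tau> ^ m))"
proof -
  \<comment> \<open>With b the weights, b i > (1 + \<epsilon>) * b (i - 1) means m - i + 1 >
    \<open>?c\<close> * i, and b i > (1 + \<epsilon>) * b (i + 1) means i + 1 > \<open>?c'\<close> *
    (m - i).\<close>
  let ?c = "(1 + \<epsilon>) / z" and ?c' = "(1 + \<epsilon>) * z"
  have "1 * 1 + z * (- ?c) < 0" using z \<epsilon> by (simp add: field_simps)
  from chernoff_base[OF this] obtain h1 where h1: "h1 > 0"
    "\<And>h. 0 < h \<Longrightarrow> h < h1 \<Longrightarrow> 1 * exp (1 * h) + z * exp (- ?c * h) < 1 + z" by blast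
  have "1 * (- ?c') + z * 1 < 0" using z \<epsilon> by (simp add: field_simps)
  from chernoff_base[OF this] obtain h2 where h2: "h2 > 0"
    "\<And>h. 0 < h \<Longrightarrow> h < h2 \<Longrightarrow> 1 * exp (- ?c' * h) + z * exp (1 * h) < 1 + z" by blast
  obtain h where h: "0 < h" "h < h1" "h < h2"
    using h1(1) h2(1) by (meson dense min_less_iff_conj)
  define t1 where "t1 = exp h + exp (- (h * ?c)) * z"
  define t2 where "t2 = exp (- (h * ?c')) + exp h * z"
  define \<tau> where "\<tau> = max t1 t2"
  have tpos: "0 < t1" "0 < t2" unfolding t1_def t2_def using z by (simp_all add: add_pos_pos)
  have \<tau>: "0 < \<tau>" "\<tau> < 1 + z"
    using h1(2)[OF h(1,2)] h2(2)[OF h(1,3)] tpos z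
    by (auto simp: \<tau>_def t1_def t2_def mult_ac)
  have p1: "exp h * t1 ^ m \<le> exp h * \<tau> ^ m" for m
    using tpos by (intro mult_left_mono power_mono) (auto simp: \<tau>_def)
  have p2: "exp h * t2 ^ m \<le> exp h * \<tau> ^ m" for m
    using tpos by (intro mult_left_mono power_mono) (auto simp: \<tau>_def)
  have "nearly_flat \<epsilon> (binom_weight z m) (exp h * \<tau> ^ m)" for m
    unfolding nearly_flat_def
  proof (intro allI conjI)
    fix j :: int
    let ?b = "binom_weight z m"
    have nn: "0 \<le> ?b i" for i using z by (simp add: binom_weight_nonneg)
    have xx: "0 \<le> exp h * \<tau> ^ m" using \<tau> by simp
    have nn': "0 \<le> (1 + \<epsilon>) * ?b i" for i using nn[of i] \<epsilon> by simp
    show "?b (j + 1) \<le> (1 + \<epsilon>) * ?b j + exp h * \<tau> ^ m"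
    proof (cases "0 \<le> j + 1 \<and> j + 1 \<le> int m")
      case False
      then have "?b (j + 1) = 0" by (auto simp: binom_weight_def)
      then show ?thesis using nn'[of j] xx by linarith
    next
      case True
      define i where "i = nat (j + 1)"
      have i: "j + 1 = int i" "i \<le> m" using True by (auto simp: i_def)
      show ?thesis
      proof (cases "?c * real i \<le> real (m - i) + 1")
        case True
        have "?b (j + 1) \<le> exp h * t1 ^ m"
          using binomial_tail[OF z h(1) i(2) True] by (simp add: i t1_def binom_weight_def)
        then show ?thesis using p1[of m] nn'[of j] by linarith
      next
        case False
        then have "i \<noteq> 0" by (cases i) auto
        then obtain k where k: "i = Suc k" by (cases i) auto
        have jk: "j = int k" using i k by simp
        have "?b (j + 1) * real (k + 1) = ?b j * (z * real (m - k))"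
          using binom_weight_step[of k m z] i k jk by simp
        also have "z * real (m - k) \<le> (1 + \<epsilon>) * real (k + 1)"
          using False z i k by (simp add: field_simps of_nat_diff)
        then have "?b j * (z * real (m - k)) \<le> ?b j * ((1 + \<epsilon>) * real (k + 1))"
          by (intro mult_left_mono nn)
        finally have "?b (j + 1) * real (k + 1) \<le> ((1 + \<epsilon>) * ?b j) * real (k + 1)"
          by (simp add: mult_ac)
        then have "?b (j + 1) \<le> (1 + \<epsilon>) * ?b j" by (rule mult_right_le_imp_le) simp
        then show ?thesis using xx by linarith
      qed
    qed
    show "?b j \<le> (1 + \<epsilon>) * ?b (j + 1) + exp h * \<tau> ^ m"
    proof (cases "0 \<le> j \<and> j \<le> int m")
      case False
      then have "?b j = 0" by (auto simp: binom_weight_def)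
      then show ?thesis using nn'[of "j+1"] xx by linarith
    next
      case True
      define i where "i = nat j"
      have i: "j = int i" "i \<le> m" using True by (auto simp: i_def)
      show ?thesis
      proof (cases "?c' * real (m - i) \<le> real i + 1")
        case True
        have "?b j \<le> exp h * t2 ^ m"
          using binomial_tail'[OF z h(1) i(2) True] by (simp add: i t2_def binom_weight_def)
        then show ?thesis using p2[of m] nn'[of "j+1"] by linarith
      next
        case False
        then have im: "i < m" using i by (cases "i = m") auto
        have "?b j * (z * real (m - i)) = ?b (j + 1) * real (i + 1)"
          using binom_weight_step[OF im, of z] i by simp
        also have "\<dots> \<le> ?b (j + 1) * ((1 + \<epsilon>) * (z * real (m - i)))"
          using False im by (intro mult_left_mono nn) (simp add: mult_ac of_nat_diff)
        finally have "?b j * (z * real (m - i)) \<le> ((1 + \<epsilon>) * ?b (j + 1)) * (z * real (m - i))"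
          by (simp add: mult_ac)
        then have "?b j \<le> (1 + \<epsilon>) * ?b (j + 1)"
          by (rule mult_right_le_imp_le) (use z im in simp)
        then show ?thesis using xx by linarith
      qed
    qed
  qed
  then show ?thesis using \<tau> by (intro exI[of _ \<tau>] exI[of _ "exp h"]) auto
qed

text \<open>
  The atom \<open>binom_weight z m\<close> has total mass \<open>(1 + z) ^ m\<close> but is charged only \<open>\<tau> ^ m\<close>. For \<open>\<tau> < 1 + z\<close>
  a cost that is small compared to the mass thus witnesses that most atoms have many trials.
\<close>

inductive decomposes :: "real \<Rightarrow> real \<Rightarrow> (int \<Rightarrow> real) \<Rightarrow> real \<Rightarrow> bool" for z \<tau> where
  atom: "0 \<le> c \<Longrightarrow> decomposes z \<tau> (\<lambda>d. c * binom_weight z m (d - s)) (c * \<tau> ^ m)"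
| add: "decomposes z \<tau> f x \<Longrightarrow> decomposes z \<tau> g x' \<Longrightarrow> decomposes z \<tau> (\<lambda>d. f d + g d) (x + x')"

lemma decomposes_scale_shift:
  assumes "decomposes z \<tau> f x" "0 \<le> c"
  shows "decomposes z \<tau> (\<lambda>d. c * f (d - s)) (c * x)"
  using assms(1)
proof induction
  case (atom a m r)
  have "decomposes z \<tau> (\<lambda>d. (c * a) * binom_weight z m (d - (s + r))) ((c * a) * \<tau> ^ m)"
    using atom assms(2) by (intro decomposes.atom) simp
  then show ?case by (simp add: mult_ac diff_diff_eq)
next
  case (add f x g x')
  then show ?case using decomposes.add[OF add.IH] by (simp add: distrib_left)
qed

text \<open>Convolution with (1, z) gives every atom one more trial. The mass grows by 1 + z but the
  cost only by \<tau>; all decay of relative costs comes from here.\<close>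

lemma decomposes_smooth:
  assumes "decomposes z \<tau> f x"
  shows "decomposes z \<tau> (\<lambda>d. f d + z * f (d - 1)) (\<tau> * x)"
  using assms
proof induction
  case (atom a m r)
  have e: "d - 1 - r = (d - r) - 1" for d by simp
  have "decomposes z \<tau> (\<lambda>d. a * binom_weight z (Suc m) (d - r)) (a * \<tau> ^ Suc m)"
    using atom by (rule decomposes.atom)
  then show ?case by (simp add: binom_weight_Suc algebra_simps e)
next
  case (add f x g x')
  then show ?case using decomposes.add[OF add.IH] by (simp add: algebra_simps)
qed

lemma decomposes_nearly_flat:
  assumes "decomposes z \<tau> f x" and "\<And>m. nearly_flat \<epsilon> (binom_weight z m) (C * \<tau> ^ m)"
  shows "nearly_flat \<epsilon> f (C * x)"
  using assms(1)
proof induction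
  case (atom c m s)
  then show ?case using nearly_flat_scale_shift[OF assms(2)[of m], of c s] by (simp add: mult_ac)
next
  case (add f x g x')
  then show ?case using nearly_flat_add[OF add.IH] by (simp add: distrib_left)
qed

section \<open>The renormalisation recursion\<close>

type_synonym functional = "(int \<Rightarrow> real) \<Rightarrow> real"

text \<open>Mass, moments and point masses are the values of one functional at 1, the identity, the
  square and indicators. Requiring the axioms on all functions avoids supports and
  summability.\<close>

definition positive_linear :: "functional \<Rightarrow> bool" where
  "positive_linear L \<longleftrightarrow>
     (\<forall>g h. L (\<lambda>d. g d + h d) = L g + L h) \<and> (\<forall>c g. L (\<lambda>d. c * g d) = c * L g) \<and>
     (\<forall>g. (\<forall>d. 0 \<le> g d) \<longrightarrow> 0 \<le> L g)"

lemma positive_linearD: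
  assumes "positive_linear L"
  shows "L (\<lambda>d. g d + h d) = L g + L h" "L (\<lambda>d. c * g d) = c * L g"
    "(\<And>d. 0 \<le> g d) \<Longrightarrow> 0 \<le> L g"
  using assms by (auto simp: positive_linear_def)

lemma positive_linear_mono:
  assumes "positive_linear L" "\<And>d. g d \<le> h d"
  shows "L g \<le> L h"
proof -
  have "L h = L (\<lambda>d. g d + (h d - g d))" by simp
  also have "\<dots> = L g + L (\<lambda>d. h d - g d)" by (rule positive_linearD(1)[OF assms(1)])
  finally show ?thesis using positive_linearD(3)[OF assms(1), of "\<lambda>d. h d - g d"] assms(2) by simp
qed

lemma positive_linear_const: "positive_linear L \<Longrightarrow> L (\<lambda>d. c) = c * L (\<lambda>d. 1)"
  using positive_linearD(2)[of L c "\<lambda>_. 1"] by simp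

lemma positive_linear_sum:
  assumes "positive_linear L" "finite S"
  shows "L (\<lambda>d. \<Sum>i\<in>S. g i d) = (\<Sum>i\<in>S. L (g i))"
  using assms(2)
proof induction
  case empty
  then show ?case using positive_linear_const[OF assms(1), of 0] by simp
next
  case (insert i S)
  then show ?case by (simp add: positive_linearD(1)[OF assms(1)])
qed

lemma positive_linear_eval: "positive_linear (\<lambda>g. g d)"
  by (simp add: positive_linear_def)

lemma positive_linear_add_shift:
  assumes L: "positive_linear L" and M: "positive_linear M" and y: "0 \<le> y"
  shows "positive_linear (\<lambda>g. L g + y * M (\<lambda>d. g (d + s)))"
proof -
  have "M (\<lambda>d. g (d + s) + h (d + s)) = M (\<lambda>d. g (d + s)) + M (\<lambda>d. h (d + s))" for g h
    using positive_linearD(1)[OF M, of "\<lambda>d. g (d + s)" "\<lambda>d. h (d + s)"] .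
  moreover have "M (\<lambda>d. c * g (d + s)) = c * M (\<lambda>d. g (d + s))" for c g
    using positive_linearD(2)[OF M, of c "\<lambda>d. g (d + s)"] .
  ultimately show ?thesis
    using positive_linearD(3)[OF L] positive_linearD(3)[OF M] y
    unfolding positive_linear_def by (auto simp: positive_linearD(1,2)[OF L] distrib_left)
qed

lemma positive_linear_add:
  assumes "positive_linear L" "positive_linear M"
  shows "positive_linear (\<lambda>g. L g + M g)"
  using positive_linear_add_shift[OF assms, of 1 0] by simp

lemma positive_linear_shift_id:
  assumes L: "positive_linear L"
  shows "L (\<lambda>d. real_of_int (d + s)) = L of_int + s * L (\<lambda>_. 1)"
  using positive_linearD(1)[OF L, of of_int "\<lambda>_. s"] positive_linear_const[OF L, of s] by simp

lemma positive_linear_shift_square: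
  assumes L: "positive_linear L"
  shows "L (\<lambda>d. (real_of_int (d + s))\<^sup>2)
       = L (\<lambda>d. (real_of_int d)\<^sup>2) + 2 * real_of_int s * L of_int + (real_of_int s)\<^sup>2 * L (\<lambda>_. 1)"
proof -
  have e: "(\<lambda>d. (real_of_int (d + s))\<^sup>2)
      = (\<lambda>d. ((real_of_int d)\<^sup>2 + (2 * real_of_int s) * real_of_int d) + (real_of_int s)\<^sup>2)"
    by (auto simp: power2_eq_square algebra_simps)
  show ?thesis
    unfolding e positive_linearD(1,2)[OF L] positive_linear_const[OF L, of "(real_of_int s)\<^sup>2"] ..
qed

type_synonym state = "int \<times> functional \<times> functional"

text \<open>
  The functionals stand for \<open>g \<mapsto> \<Sum>N<q. z powi S N * g (S N)\<close>, where \<open>q\<close> is the denominator of an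
  approximation of the slope: \<open>LA\<close> for one with even and \<open>LB\<close> for one with odd numerator. The sign \<open>s\<close>,
  the direction of all shifts, is reversed as soon as the mean of \<open>LA\<close> has moved past \<open>0\<close>.
\<close>

definition advance :: "real \<Rightarrow> state \<Rightarrow> state" where
  "advance z = (\<lambda>(s, LA, LB).
     let y = z powi s;
         L1 = (\<lambda>g. LA g + y * LB (\<lambda>d. g (d + s)));
         LX = (\<lambda>g. LA g + y * L1 (\<lambda>d. g (d + s)));
         LA' = (\<lambda>g. LX g + L1 g)
     in if 0 \<le> real_of_int s * LA of_int then (- s, LA', LX) else (s, LA', L1))"

locale tilt =
  fixes z :: real
  assumes z_pos: "0 < z"
begin

primrec st :: "nat \<Rightarrow> state" where
  "st 0 = (1, \<lambda>g. g 0, \<lambda>g. g 0)"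
| "st (Suc k) = advance z (st k)"

definition sg :: "nat \<Rightarrow> int" where "sg k = fst (st k)"
definition LA :: "nat \<Rightarrow> functional" where "LA k = fst (snd (st k))"
definition LB :: "nat \<Rightarrow> functional" where "LB k = snd (snd (st k))"
definition fl :: "nat \<Rightarrow> bool" where "fl k \<longleftrightarrow> 0 \<le> real_of_int (sg k) * LA k of_int"
definition y :: "nat \<Rightarrow> real" where "y k = z powi sg k"
text \<open>\<open>L1\<close> stands for an even block followed by an odd one, \<open>LX\<close> for
  an even block followed by that. Both have odd numerator, and each is a candidate for the next
  \<open>LB\<close>.\<close>

definition L1 :: "nat \<Rightarrow> functional" where
  "L1 k = (\<lambda>g. LA k g + y k * LB k (\<lambda>d. g (d + sg k)))"
definition LX :: "nat \<Rightarrow> functional" where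
  "LX k = (\<lambda>g. LA k g + y k * L1 k (\<lambda>d. g (d + sg k)))"

lemma step_0: "sg 0 = 1" "LA 0 = (\<lambda>g. g 0)" "LB 0 = (\<lambda>g. g 0)"
  by (simp_all add: sg_def LA_def LB_def)

lemma step_Suc:
  "sg (Suc k) = (if fl k then - sg k else sg k)"
  "LA (Suc k) = (\<lambda>g. LX k g + L1 k g)"
  "LB (Suc k) = (if fl k then LX k else L1 k)"
  by (auto simp: sg_def LA_def LB_def fl_def L1_def LX_def y_def advance_def Let_def split: prod.splits)

lemma sg_cases: "sg k = 1 \<or> sg k = -1"
  by (induction k) (auto simp: step_0 step_Suc)

lemma y_pos: "0 < y k"
  using z_pos by (simp add: y_def)

definition Y :: real where "Y = max z (1 / z)"

lemma Y_ge_1: "1 \<le> Y"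
  using z_pos by (cases "1 \<le> z") (auto simp: Y_def field_simps le_max_iff_disj)

lemma y_bounds: "y k \<le> Y" "1 \<le> Y * y k"
proof -
  have "y k = z \<or> y k = 1 / z"
    using sg_cases[of k] by (auto simp: y_def power_int_minus divide_inverse)
  moreover have "z \<le> Y" "1 / z \<le> Y" by (auto simp: Y_def)
  moreover have "1 \<le> Y * z" "1 \<le> Y * (1 / z)" using calculation(2,3) z_pos by (simp_all add: field_simps)
  ultimately show "y k \<le> Y" "1 \<le> Y * y k" by metis+
qed

lemma positive_linear_AB: "positive_linear (LA k) \<and> positive_linear (LB k)"
proof (induction k)
  case 0
  then show ?case by (simp add: step_0 positive_linear_eval)
next
  case (Suc k)
  have 1: "positive_linear (L1 k)"
    unfolding L1_def using Suc y_pos[of k] by (intro positive_linear_add_shift) auto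
  then have X: "positive_linear (LX k)"
    unfolding LX_def using Suc y_pos[of k] by (intro positive_linear_add_shift) auto
  show ?case using 1 X positive_linear_add[OF X 1] by (simp add: step_Suc)
qed

lemma pl: "positive_linear (LA k)" "positive_linear (LB k)" "positive_linear (L1 k)"
proof -
  show "positive_linear (LA k)" "positive_linear (LB k)" using positive_linear_AB by auto
  then show "positive_linear (L1 k)"
    unfolding L1_def using y_pos[of k] by (intro positive_linear_add_shift) auto
qed

section \<open>Total masses\<close>

definition al :: "nat \<Rightarrow> real" where "al k = LA k (\<lambda>_. 1)"
definition be :: "nat \<Rightarrow> real" where "be k = LB k (\<lambda>_. 1)"
definition b1 :: "nat \<Rightarrow> real" where "b1 k = L1 k (\<lambda>_. 1)"

lemma weight_0: "al 0 = 1" "be 0 = 1"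
  by (simp_all add: al_def be_def step_0)

lemma b1_eq: "b1 k = al k + y k * be k"
  by (simp add: al_def be_def b1_def L1_def)

lemma weight_Suc:
  "al (Suc k) = al k + (1 + y k) * b1 k"
  "be (Suc k) = (if fl k then al k + y k * b1 k else b1 k)"
  by (simp_all add: al_def be_def b1_def step_Suc LX_def algebra_simps)

definition R :: real where "R = 1 + (1 + Y)\<^sup>2"

text \<open>As y \<le> Y and \<open>be\<close> \<le> \<open>al\<close>, the mass \<open>b1\<close>
  lies between \<open>al\<close> and (1 + Y) * \<open>al\<close>. So the new \<open>al\<close> is at
  most 1 + (1 + Y)^2 times the old one, while the new \<open>be\<close> is at least the old
  \<open>al\<close> in either case.\<close>

lemma weight_ratio: "0 < be k \<and> be k \<le> al k \<and> al k \<le> R * be k"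
proof (induction k)
  case 0
  then show ?case by (simp add: weight_0 R_def)
next
  case (Suc k)
  define u where "u = y k"
  have u: "0 < u" "u \<le> Y" using y_pos y_bounds by (auto simp: u_def)
  have al: "0 < al k" using Suc by linarith
  have ub: "0 < u * be k" using Suc u by simp
  have b1: "al k \<le> b1 k" "b1 k \<le> (1 + Y) * al k" "0 < b1 k"
  proof -
    show "al k \<le> b1 k" using ub by (simp add: b1_eq u_def)
    then show "0 < b1 k" using al by linarith
    have "u * be k \<le> Y * al k" using u Suc by (intro mult_mono) auto
    then show "b1 k \<le> (1 + Y) * al k" by (simp add: b1_eq u_def algebra_simps)
  qed
  have ub1: "0 < u * b1 k" "u * b1 k \<le> Y * b1 k" using u b1 by auto
  have Y1: "Y * b1 k \<le> Y * ((1 + Y) * al k)" using b1 Y_ge_1 by (intro mult_left_mono) auto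
  have yy: "0 \<le> Y * Y * al k" "0 \<le> Y * Y * b1 k" "0 \<le> Y * b1 k" "0 \<le> Y * al k"
    using Y_ge_1 al b1 by auto
  have r: "0 < be (Suc k) \<and> be (Suc k) \<le> al (Suc k)"
    using al b1 ub1 by (auto simp: weight_Suc u_def algebra_simps)
  have "al (Suc k) \<le> R * be (Suc k)"
  proof (cases "fl k")
    case True
    have "al (Suc k) = al k + b1 k + u * b1 k"
      by (simp add: weight_Suc u_def algebra_simps)
    moreover have "R * al k = al k + (1 + Y) * al k + Y * ((1 + Y) * al k)"
      by (simp add: R_def power2_eq_square algebra_simps)
    ultimately have "al (Suc k) \<le> R * al k" using b1 ub1 Y1 by linarith
    also have "\<dots> \<le> R * be (Suc k)"
      using True ub1 by (intro mult_left_mono) (auto simp: weight_Suc u_def R_def)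
    finally show ?thesis .
  next
    case False
    then have "be (Suc k) = b1 k" by (simp add: weight_Suc)
    moreover have "al (Suc k) = al k + b1 k + u * b1 k"
      by (simp add: weight_Suc u_def algebra_simps)
    moreover have "R * b1 k = 2 * b1 k + 2 * (Y * b1 k) + Y * Y * b1 k"
      by (simp add: R_def power2_eq_square algebra_simps)
    ultimately show ?thesis using b1(1) ub1(2) yy(2,3) by simp
  qed
  then show ?case using r by simp
qed

lemma weight_pos: "0 < al k" "0 < be k" "0 < b1 k"
  using weight_ratio[of k] y_pos[of k] by (auto simp: b1_eq intro: add_pos_pos)

lemma al_le_b1: "al k \<le> b1 k"
  using y_pos[of k] weight_pos[of k] by (simp add: b1_eq)

lemma b1_le: "b1 k \<le> (1 + Y) * al k"
proof -
  have "y k * be k \<le> Y * al k"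
    using y_bounds[of k] weight_ratio[of k] y_pos[of k] Y_ge_1 by (intro mult_mono) auto
  then show ?thesis by (simp add: b1_eq algebra_simps)
qed

lemma al_Suc_le: "al (Suc k) \<le> R * al k"
proof -
  have "(1 + y k) * b1 k \<le> (1 + Y) * ((1 + Y) * al k)"
    using y_bounds[of k] b1_le[of k] weight_pos[of k] Y_ge_1 by (intro mult_mono) auto
  then show ?thesis by (simp add: weight_Suc R_def power2_eq_square algebra_simps)
qed

section \<open>Means\<close>

definition mA :: "nat \<Rightarrow> real" where "mA k = LA k of_int / al k"
definition mB :: "nat \<Rightarrow> real" where "mB k = LB k of_int / be k"

lemma first_moment_L1: "L1 k of_int = al k * mA k + y k * be k * (mB k + real_of_int (sg k))"
  using weight_pos[of k] positive_linear_shift_id[OF pl(2), of k "sg k"]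
  by (simp add: L1_def mA_def mB_def be_def algebra_simps)

lemma mean_L1: "\<exists>t. 0 \<le> t \<and> t \<le> Y / (1 + Y) \<and>
   L1 k of_int / b1 k = (1 - t) * mA k + t * (mB k + real_of_int (sg k))"
proof (intro exI conjI)
  let ?t = "y k * be k / b1 k"
  have p: "0 < al k" "0 < b1 k" "0 < be k" "0 < y k" using weight_pos y_pos by auto
  show "0 \<le> ?t" using p by simp
  have "y k * be k \<le> Y * al k"
    using y_bounds[of k] weight_ratio[of k] p Y_ge_1 by (intro mult_mono) auto
  then have "y k * be k * (1 + Y) \<le> Y * b1 k" by (simp add: b1_eq algebra_simps)
  then show "?t \<le> Y / (1 + Y)" using p Y_ge_1 by (simp add: field_simps)
  have "1 - ?t = al k / b1 k" using p by (simp add: b1_eq field_simps)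
  then show "L1 k of_int / b1 k = (1 - ?t) * mA k + ?t * (mB k + real_of_int (sg k))"
    by (simp add: first_moment_L1 add_divide_distrib)
qed

text \<open>Each block of the next level is a mixture of copies of \<open>LA\<close> and
  \<open>LB\<close> displaced by 0, 1 or 2 in the direction \<open>sg k\<close>. The bound \<theta>
  < 1 on the share of \<open>LB\<close>, common to both new blocks, makes the difference of the
  means contract.\<close>

lemma mean_step:
  fixes k
  defines "\<theta> \<equiv> Y / (1 + Y)"
  shows "\<exists>t c. 0 \<le> t \<and> t \<le> \<theta> \<and> 0 \<le> c \<and> c \<le> 2 \<and>
           mA (Suc k) = (1 - t) * mA k + t * mB k + real_of_int (sg k) * c" (is ?A)
    and "\<exists>t c. 0 \<le> t \<and> t \<le> \<theta> \<and> 0 \<le> c \<and> c \<le> 2 \<and>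
           mB (Suc k) = (1 - t) * mA k + t * mB k + real_of_int (sg k) * c" (is ?B)
proof -
  obtain t where t: "0 \<le> t" "t \<le> \<theta>"
    and m1: "L1 k of_int / b1 k = (1 - t) * mA k + t * (mB k + real_of_int (sg k))"
    using mean_L1[of k] by (auto simp: \<theta>_def)
  have \<theta>1: "0 \<le> \<theta>" "\<theta> \<le> 1" using Y_ge_1 by (auto simp: \<theta>_def)
  have p: "0 < al k" "0 < b1 k" "0 < be k" "0 < y k" using weight_pos y_pos by auto
  have L1: "L1 k of_int = b1 k * ((1 - t) * mA k + t * (mB k + real_of_int (sg k)))"
    using m1 p by (simp add: field_simps)
  have LX: "LX k of_int = al k * mA k + y k * (L1 k of_int + real_of_int (sg k) * b1 k)"
    using p positive_linear_shift_id[OF pl(3), of k "sg k"]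
    by (simp add: LX_def mA_def b1_def)
  have conv: "\<exists>t c. 0 \<le> t \<and> t \<le> \<theta> \<and> 0 \<le> c \<and> c \<le> 2 \<and>
           (1 - w) * mA k + w * ((1 - t') * mA k + t' * (mB k + real_of_int (sg k))) + v * real_of_int (sg k)
            = (1 - t) * mA k + t * mB k + real_of_int (sg k) * c"
    if "0 \<le> w" "w \<le> 1" "0 \<le> v" "v \<le> 1" "t' = t" for w v t' :: real
  proof (intro exI conjI)
    show "0 \<le> w * t'" using that t by simp
    have wt: "w * t' \<le> 1 * t" using that t by (intro mult_mono) auto
    then show "w * t' \<le> \<theta>" using t by simp
    show "0 \<le> w * t' + v" using that t by simp
    show "w * t' + v \<le> 2" using wt that t \<theta>1 by linarith
  qed (simp add: algebra_simps)
  have N: "0 < al k + (1 + y k) * b1 k" "0 < al k + y k * b1 k" using p by (auto intro!: add_pos_pos)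
  let ?w = "(1 + y k) * b1 k / al (Suc k)" and ?v = "y k * b1 k / al (Suc k)"
  let ?M = "(1 - t) * mA k + t * (mB k + real_of_int (sg k))"
  have "mA (Suc k) = (al k * mA k + (1 + y k) * b1 k * ?M + y k * b1 k * real_of_int (sg k)) / al (Suc k)"
    unfolding mA_def[of "Suc k"] step_Suc LX L1 by (simp add: algebra_simps)
  also have "\<dots> = (1 - ?w) * mA k + ?w * ?M + ?v * real_of_int (sg k)"
  proof -
    have "1 - ?w = al k / al (Suc k)" using N by (simp add: weight_Suc field_simps)
    then show ?thesis by (simp add: add_divide_distrib)
  qed
  finally have A: "mA (Suc k) = (1 - ?w) * mA k + ?w * ?M + ?v * real_of_int (sg k)" .
  have "0 \<le> ?w" "?w \<le> 1" "0 \<le> ?v" "?v \<le> 1"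
    using p N by (auto simp: weight_Suc divide_simps algebra_simps)
  from conv[OF this refl] show ?A unfolding A .
  show ?B
  proof (cases "fl k")
    case False
    then have "mB (Suc k) = (1 - 1) * mA k + 1 * ?M + 0 * real_of_int (sg k)"
      using p by (simp add: mB_def step_Suc weight_Suc L1)
    then show ?thesis using conv[of 1 0 t] by simp
  next
    case True
    let ?w = "y k * b1 k / be (Suc k)"
    have "mB (Suc k) = (al k * mA k + y k * b1 k * ?M + y k * b1 k * real_of_int (sg k)) / be (Suc k)"
      using True unfolding mB_def[of "Suc k"] step_Suc by (simp add: LX L1 algebra_simps)
    also have "\<dots> = (1 - ?w) * mA k + ?w * ?M + ?w * real_of_int (sg k)"
    proof -
      have "1 - ?w = al k / be (Suc k)" using N True by (simp add: weight_Suc field_simps)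
      then show ?thesis by (simp add: add_divide_distrib)
    qed
    finally have B: "mB (Suc k) = (1 - ?w) * mA k + ?w * ?M + ?w * real_of_int (sg k)" .
    have "0 \<le> ?w" "?w \<le> 1"
      using p N True by (auto simp: weight_Suc divide_simps algebra_simps)
    from conv[OF this this refl] show ?thesis unfolding B .
  qed
qed

text \<open>Fixed point of x \<mapsto> Y / (1 + Y) * x + 2: a step multiplies the difference of the
  means by at most Y / (1 + Y) in modulus and adds at most 2.\<close>

definition D :: real where "D = 2 * (1 + Y)"

lemma mean_diff: "\<bar>mA k - mB k\<bar> \<le> D"
proof (induction k)
  case 0
  then show ?case using Y_ge_1 by (simp add: mA_def mB_def step_0 D_def)
next
  case (Suc k)
  let ?\<theta> = "Y / (1 + Y)"
  obtain t c where A: "0 \<le> t" "t \<le> ?\<theta>" "0 \<le> c" "c \<le> 2"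
    "mA (Suc k) = (1 - t) * mA k + t * mB k + real_of_int (sg k) * c" using mean_step(1) by blast
  obtain t' c' where B: "0 \<le> t'" "t' \<le> ?\<theta>" "0 \<le> c'" "c' \<le> 2"
    "mB (Suc k) = (1 - t') * mA k + t' * mB k + real_of_int (sg k) * c'" using mean_step(2) by blast
  have "mA (Suc k) - mB (Suc k) = (t' - t) * (mA k - mB k) + real_of_int (sg k) * (c - c')"
    unfolding A(5) B(5) by (simp add: algebra_simps)
  also have "\<bar>\<dots>\<bar> \<le> \<bar>t' - t\<bar> * \<bar>mA k - mB k\<bar> + \<bar>c - c'\<bar>"
    using sg_cases[of k] abs_triangle_ineq[of "(t' - t) * (mA k - mB k)" "real_of_int (sg k) * (c - c')"]
    by (auto simp: abs_mult)
  finally have "\<bar>mA (Suc k) - mB (Suc k)\<bar> \<le> \<bar>t' - t\<bar> * \<bar>mA k - mB k\<bar> + \<bar>c - c'\<bar>" .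
  moreover have "\<bar>t' - t\<bar> * \<bar>mA k - mB k\<bar> \<le> ?\<theta> * D"
    using A B Suc by (intro mult_mono) auto
  moreover have "\<bar>c - c'\<bar> \<le> 2" using A B by auto
  moreover have "?\<theta> * D + 2 = D" using Y_ge_1 by (simp add: D_def field_simps)
  ultimately show ?case by linarith
qed

definition M :: real where "M = 2 * D + 4"

text \<open>Measured in the current direction, a step never falls below the smaller mean and exceeds
  the larger one by at most 2. While the direction is kept, the mean of \<open>LA\<close> was
  negative, so it ends at or below D + 2. On reversal the upper bound (D + 2) + D + 2 = M for both
  new means becomes the lower bound -M.\<close>

lemma mean_invariant:
  "- M \<le> real_of_int (sg k) * mA k \<and> - M \<le> real_of_int (sg k) * mB k \<and> real_of_int (sg k) * mA k \<le> D + 2"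
proof (induction k)
  case 0
  then show ?case using Y_ge_1 by (simp add: mA_def mB_def step_0 D_def M_def)
next
  case (Suc k)
  define a where "a = real_of_int (sg k) * mA k"
  define b where "b = real_of_int (sg k) * mB k"
  have D0: "0 \<le> D" using Y_ge_1 by (simp add: D_def)
  have \<theta>1: "Y / (1 + Y) \<le> 1" using Y_ge_1 by simp
  have ab: "\<bar>a - b\<bar> \<le> D"
    using mean_diff[of k] sg_cases[of k] by (auto simp: a_def b_def)
  have bnd: "min a b \<le> real_of_int (sg k) * m \<and> real_of_int (sg k) * m \<le> max a b + 2"
    if "0 \<le> t" "t \<le> Y / (1 + Y)" "0 \<le> c" "c \<le> 2" "m = (1 - t) * mA k + t * mB k + real_of_int (sg k) * c"
    for t c m :: real
  proof -
    have e: "real_of_int (sg k) * m = (1 - t) * a + t * b + c"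
      unfolding that(5) a_def b_def using sg_cases[of k] by (auto simp: algebra_simps)
    have "(1 - t) * min a b \<le> (1 - t) * a" "t * min a b \<le> t * b"
         "(1 - t) * a \<le> (1 - t) * max a b" "t * b \<le> t * max a b"
      using that \<theta>1 by (auto intro!: mult_left_mono)
    then have "min a b \<le> (1 - t) * a + t * b" "(1 - t) * a + t * b \<le> max a b"
      by (simp_all add: left_diff_distrib)
    then show ?thesis unfolding e using that(3,4) by linarith
  qed
  have A: "min a b \<le> real_of_int (sg k) * mA (Suc k) \<and> real_of_int (sg k) * mA (Suc k) \<le> max a b + 2"
    using mean_step(1)[of k] bnd by blast
  have B: "min a b \<le> real_of_int (sg k) * mB (Suc k) \<and> real_of_int (sg k) * mB (Suc k) \<le> max a b + 2"
    using mean_step(2)[of k] bnd by blast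
  have inv: "- M \<le> a" "- M \<le> b" "a \<le> D + 2" using Suc by (auto simp: a_def b_def)
  have fl: "fl k \<longleftrightarrow> 0 \<le> a"
    using weight_pos[of k] by (simp add: fl_def a_def mA_def zero_le_divide_iff zero_le_mult_iff)
  show ?case
  proof (cases "fl k")
    case True
    then have s: "real_of_int (sg (Suc k)) = - real_of_int (sg k)" by (simp add: step_Suc)
    show ?thesis unfolding s using True fl A B ab inv D0 by (simp add: M_def) linarith
  next
    case False
    then have s: "sg (Suc k) = sg k" by (simp add: step_Suc)
    show ?thesis unfolding s using False fl A B ab inv D0 by linarith
  qed
qed

lemma mean_bound: "\<bar>LA k of_int\<bar> \<le> M * al k" "\<bar>LB k of_int\<bar> \<le> M * be k"
proof -
  have D0: "0 \<le> D" using Y_ge_1 by (simp add: D_def)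
  have "\<bar>mA k\<bar> \<le> M" "\<bar>mB k\<bar> \<le> M"
    using mean_invariant[of k] mean_diff[of k] D0 sg_cases[of k] by (auto simp: M_def)
  then show "\<bar>LA k of_int\<bar> \<le> M * al k" "\<bar>LB k of_int\<bar> \<le> M * be k"
    using weight_pos[of k] by (simp_all add: mA_def mB_def abs_divide field_simps)
qed

text \<open>A shift by \<plusminus>1 changes the second moment by at most twice the modulus of the
  first moment plus the mass, and the means are bounded. A step shifts at most twice: 2 * M + 1 for
  the shift of \<open>LB\<close>, and 2 * (M + 1) + 1 for that of \<open>L1\<close>, whose mean is
  bounded by M + 1; the sum is c.\<close>

lemma second_moment:
  defines "c \<equiv> 4 * M + 4"
  shows "LA k (\<lambda>d. (real_of_int d)\<^sup>2) \<le> c * k * al k \<and> LB k (\<lambda>d. (real_of_int d)\<^sup>2) \<le> c * k * be k"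
proof (induction k)
  case 0
  then show ?case by (simp add: step_0)
next
  case (Suc k)
  have M0: "0 \<le> M" using Y_ge_1 by (simp add: M_def D_def)
  let ?q = "\<lambda>d::int. (real_of_int d)\<^sup>2"
  have p: "0 < al k" "0 < b1 k" "0 < be k" "0 < y k" using weight_pos y_pos by auto
  have s2: "(real_of_int (sg k))\<^sup>2 = 1" using sg_cases[of k] by auto
  have s1: "real_of_int (sg k) * x \<le> \<bar>x\<bar>" for x :: real using sg_cases[of k] by auto
  have shB: "LB k (\<lambda>d. ?q (d + sg k)) \<le> (c * k + 2 * M + 1) * be k"
    using Suc s1[of "LB k of_int"] mean_bound(2)[of k]
    unfolding positive_linear_shift_square[OF pl(2)] s2 be_def[symmetric] by (simp add: algebra_simps)
  have "y k * LB k (\<lambda>d. ?q (d + sg k)) \<le> y k * ((c * k + 2 * M + 1) * be k)"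
    using shB p by (intro mult_left_mono) auto
  moreover have "0 \<le> (2 * M + 1) * al k" using M0 p by simp
  ultimately have L1: "L1 k ?q \<le> (c * k + 2 * M + 1) * b1 k"
    using Suc by (simp add: L1_def b1_eq algebra_simps)
  have "\<bar>L1 k of_int\<bar> \<le> \<bar>LA k of_int\<bar> + y k * (\<bar>LB k of_int\<bar> + be k)"
  proof -
    have "\<bar>LB k of_int + real_of_int (sg k) * be k\<bar> \<le> \<bar>LB k of_int\<bar> + be k"
      using sg_cases[of k] p by auto
    then have "\<bar>y k * (LB k of_int + real_of_int (sg k) * be k)\<bar> \<le> y k * (\<bar>LB k of_int\<bar> + be k)"
      using p by (simp add: abs_mult)
    then show ?thesis
      unfolding L1_def positive_linear_shift_id[OF pl(2)] be_def[symmetric] by linarith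
  qed
  also have "\<dots> \<le> M * al k + y k * (M * be k + be k)"
    using mean_bound[of k] p by (intro add_mono mult_left_mono) auto
  also have "\<dots> \<le> (M + 1) * b1 k" using p M0 by (simp add: b1_eq algebra_simps)
  finally have m1: "\<bar>L1 k of_int\<bar> \<le> (M + 1) * b1 k" .
  have sh1: "L1 k (\<lambda>d. ?q (d + sg k)) \<le> (c * k + 4 * M + 4) * b1 k"
    using L1 s1[of "L1 k of_int"] m1
    unfolding positive_linear_shift_square[OF pl(3)] s2 b1_def[symmetric] by (simp add: algebra_simps)
  have ysh1: "y k * L1 k (\<lambda>d. ?q (d + sg k)) \<le> y k * ((c * k + 4 * M + 4) * b1 k)"
    using sh1 p by (intro mult_left_mono) auto
  have ck: "c * real (Suc k) = c * k + 4 * M + 4" by (simp add: c_def algebra_simps)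
  have LXq: "LX k ?q \<le> (c * Suc k) * (al k + y k * b1 k)"
  proof -
    have "0 \<le> (4 * M + 4) * al k" using M0 p by simp
    then show ?thesis using Suc ysh1 unfolding ck by (simp add: LX_def algebra_simps)
  qed
  have L1q: "L1 k ?q \<le> (c * Suc k) * b1 k"
  proof -
    have "0 \<le> (2 * M + 3) * b1 k" using M0 p by simp
    then show ?thesis using L1 unfolding ck by (simp add: algebra_simps)
  qed
  have "LA (Suc k) ?q \<le> c * Suc k * al (Suc k)"
    using LXq L1q unfolding step_Suc weight_Suc by (simp add: algebra_simps del: of_nat_Suc)
  moreover have "LB (Suc k) ?q \<le> c * Suc k * be (Suc k)"
    using LXq L1q unfolding step_Suc weight_Suc by (cases "fl k") auto
  ultimately show ?case ..
qed

section \<open>Point masses as mixtures of binomials\<close>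

definition fA :: "nat \<Rightarrow> int \<Rightarrow> real" where "fA k d = LA k (\<lambda>x. if x = d then 1 else 0)"
definition fB :: "nat \<Rightarrow> int \<Rightarrow> real" where "fB k d = LB k (\<lambda>x. if x = d then 1 else 0)"
definition f1 :: "nat \<Rightarrow> int \<Rightarrow> real" where "f1 k d = fA k d + y k * fB k (d - sg k)"

lemma f_0: "fA 0 d = (if d = 0 then 1 else 0)" "fB 0 d = (if d = 0 then 1 else 0)"
  by (simp_all add: fA_def fB_def step_0)

lemma f_Suc:
  "fA (Suc k) d = fA k d + f1 k d + y k * f1 k (d - sg k)"
  "fB (Suc k) d = (if fl k then fA k d + y k * f1 k (d - sg k) else f1 k d)"
proof -
  have sh: "(\<lambda>x. if x + sg k = e then 1 else 0) = (\<lambda>x. if x = e - sg k then 1 else (0::real))" for e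
    by auto
  have "L1 k (\<lambda>x. if x = d then 1 else 0) = f1 k d" for d
    by (simp add: L1_def f1_def fA_def fB_def sh)
  then show "fA (Suc k) d = fA k d + f1 k d + y k * f1 k (d - sg k)"
    "fB (Suc k) d = (if fl k then fA k d + y k * f1 k (d - sg k) else f1 k d)"
    by (simp_all add: fA_def fB_def step_Suc LX_def sh)
qed

text \<open>For direction -1 the kernel with weights 1 at 0 and 1 / z at -1 is a translate of (1, z)
  divided by z. So either direction improves the ratio of cost to mass by \<tau> / (1 + z).\<close>

lemma decomposes_step:
  assumes "decomposes z \<tau> f x"
  shows "decomposes z \<tau> (\<lambda>d. f d + y k * f (d - sg k)) (\<tau> * (1 + y k) / (1 + z) * x)"
proof (cases "sg k = 1")
  case True
  then have "y k = z" by (simp add: y_def)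
  then show ?thesis using decomposes_smooth[OF assms] True z_pos by simp
next
  case False
  then have s: "sg k = -1" using sg_cases[of k] by simp
  then have yk: "y k = 1 / z" by (simp add: y_def power_int_minus divide_inverse)
  have "\<tau> * (1 + y k) / (1 + z) = \<tau> / z"
  proof -
    have "1 + y k = (1 + z) / z" using z_pos by (simp add: yk field_simps)
    then show ?thesis using z_pos by simp
  qed
  moreover have "decomposes z \<tau> (\<lambda>d. (1 / z) * (f (d - (-1)) + z * f (d - (-1) - 1))) ((1 / z) * (\<tau> * x))"
    using z_pos by (intro decomposes_scale_shift decomposes_smooth assms) simp
  ultimately show ?thesis using z_pos s by (simp add: yk algebra_simps)
qed

text \<open>The gain \<kappa>0 of a smoothing is collected only in the next \<open>fA\<close>, which
  contains the convolution of \<open>f1\<close>. The costs of \<open>fB\<close> are therefore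
  allowed a relative excess \<mu> > 1: mixing with the cheaper \<open>fA\<close> brings the excess
  down by \<kappa>, and smoothing an \<open>f1\<close> of excess \<mu> still gains because \<kappa>0
  * \<mu> < 1.\<close>

lemma decomposition_cost:
  assumes \<tau>: "0 < \<tau>" "\<tau> < 1 + z"
  shows "\<exists>\<kappa> \<mu>. 0 < \<kappa> \<and> \<kappa> < 1 \<and> 0 < \<mu> \<and>
    (\<forall>k. \<exists>xA xB. decomposes z \<tau> (fA k) xA \<and> decomposes z \<tau> (fB k) xB \<and>
       xA \<le> \<kappa> ^ k * al k \<and> xB \<le> \<mu> * (\<kappa> ^ k * be k))"
proof -
  define \<kappa>0 where "\<kappa>0 = \<tau> / (1 + z)"
  have \<kappa>0: "0 < \<kappa>0" "\<kappa>0 < 1" using \<tau> z_pos by (auto simp: \<kappa>0_def)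
  define \<mu> where "\<mu> = 2 / (1 + \<kappa>0)"
  have \<mu>: "1 < \<mu>" "\<kappa>0 * \<mu> < 1" "\<mu> < 2" using \<kappa>0 by (auto simp: \<mu>_def field_simps)
  \<comment> \<open>The three terms keep \<kappa> positive, pay for the mixing inequality
    \<open>mix\<close>, and fit 2 * \<gamma> into the net gain 1 - \<kappa>0 * \<mu> of a
    smoothing.\<close>
  define \<gamma> where "\<gamma> = min (1 / 2) (min ((\<mu> - 1) / (\<mu> * (1 + Y * (1 + Y)))) ((1 - \<kappa>0 * \<mu>) / 2))"
  have YY: "0 < 1 + Y * (1 + Y)" using Y_ge_1 by (intro add_pos_nonneg) auto
  have \<gamma>: "0 < \<gamma>" "\<gamma> \<le> 1/2" "\<gamma> \<le> (\<mu> - 1) / (\<mu> * (1 + Y * (1 + Y)))" "\<gamma> \<le> (1 - \<kappa>0 * \<mu>) / 2"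
  proof -
    show "0 < \<gamma>" using \<mu> YY by (auto simp: \<gamma>_def)
    show "\<gamma> \<le> 1/2" unfolding \<gamma>_def by (rule min.cobounded1)
    show "\<gamma> \<le> (\<mu> - 1) / (\<mu> * (1 + Y * (1 + Y)))"
      unfolding \<gamma>_def by (rule min.coboundedI2[OF min.cobounded1])
    show "\<gamma> \<le> (1 - \<kappa>0 * \<mu>) / 2"
      unfolding \<gamma>_def by (rule min.coboundedI2[OF min.cobounded2])
  qed
  have \<gamma>1: "\<gamma> * \<mu> * (1 + Y * (1 + Y)) \<le> \<mu> - 1"
  proof -
    have "0 < \<mu> * (1 + Y * (1 + Y))" using \<mu> YY by simp
    from \<gamma>(3)[unfolded pos_le_divide_eq[OF this]] show ?thesis by (simp only: mult.assoc)
  qed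
  define \<kappa> where "\<kappa> = 1 - \<gamma>"
  have \<kappa>: "0 < \<kappa>" "\<kappa> < 1" using \<gamma> by (auto simp: \<kappa>_def)
  \<comment> \<open>Replacing a weight by \<open>\<mu>\<close> times itself is paid for by the other summand.\<close>
  have mix: "a + \<mu> * b \<le> \<mu> * (\<kappa> * (a + b))" if "0 \<le> a" "0 \<le> b" "b \<le> Y * (1 + Y) * a" for a b
  proof -
    have "\<gamma> * \<mu> * b \<le> \<gamma> * \<mu> * (Y * (1 + Y) * a)"
      using that \<gamma> \<mu> by (intro mult_left_mono) auto
    moreover have "\<gamma> * \<mu> * (1 + Y * (1 + Y)) * a \<le> (\<mu> - 1) * a"
      using that by (intro mult_right_mono \<gamma>1) auto
    ultimately show ?thesis by (simp add: \<kappa>_def algebra_simps)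
  qed
  have "\<exists>xA xB. decomposes z \<tau> (fA k) xA \<and> decomposes z \<tau> (fB k) xB \<and>
       xA \<le> \<kappa> ^ k * al k \<and> xB \<le> \<mu> * (\<kappa> ^ k * be k)" for k
  proof (induction k)
    case 0
    have "(\<lambda>d. 1 * binom_weight z 0 (d - 0)) = (\<lambda>d. if d = 0 then 1 else 0)"
      by (auto simp: binom_weight_def)
    then have "decomposes z \<tau> (\<lambda>d. if d = 0 then 1 else 0) 1"
      using decomposes.atom[of 1 z \<tau> 0 0] by simp
    then show ?case using \<mu> by (intro exI[of _ 1]) (auto simp: f_0[abs_def] weight_0)
  next
    case (Suc k)
    then obtain xA xB where dA: "decomposes z \<tau> (fA k) xA" and dB: "decomposes z \<tau> (fB k) xB"
      and xA: "xA \<le> \<kappa> ^ k * al k" and xB: "xB \<le> \<mu> * (\<kappa> ^ k * be k)" by blast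
    define X where "X = \<kappa> ^ k"
    have X: "0 < X" using \<kappa> by (simp add: X_def)
    have p: "0 < al k" "0 < b1 k" "0 < be k" "0 < y k" using weight_pos y_pos by auto
    have yY: "y k \<le> Y" by (rule y_bounds)
    define x1 where "x1 = xA + y k * xB"
    have d1: "decomposes z \<tau> (f1 k) x1"
      unfolding f1_def[abs_def] x1_def
      using p by (intro decomposes.add dA decomposes_scale_shift dB) simp
    have "y k * xB \<le> y k * (\<mu> * (X * be k))" using xB p by (intro mult_left_mono) (auto simp: X_def)
    then have x1: "x1 \<le> X * (al k + \<mu> * (y k * be k))"
      using xA by (simp add: x1_def X_def algebra_simps)
    have yb: "y k * be k \<le> Y * al k"
      using weight_ratio[of k] p Y_ge_1 yY by (intro mult_mono) auto
    also have "\<dots> \<le> Y * (1 + Y) * al k"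
      using p Y_ge_1 by (simp add: mult_right_mono)
    finally have yb': "y k * be k \<le> Y * (1 + Y) * al k" .
    have "al k + \<mu> * (y k * be k) \<le> \<mu> * (\<kappa> * b1 k)"
      unfolding b1_eq using p yb' by (intro mix) auto
    then have "X * (al k + \<mu> * (y k * be k)) \<le> X * (\<mu> * (\<kappa> * b1 k))"
      using X by (intro mult_left_mono) auto
    with x1 have x1k: "x1 \<le> \<mu> * (X * \<kappa> * b1 k)" by (simp add: mult_ac)
    have x1m: "x1 \<le> \<mu> * (X * b1 k)"
    proof -
      have "\<mu> * (X * \<kappa> * b1 k) = \<kappa> * (\<mu> * (X * b1 k))" by (simp add: mult_ac)
      also have "\<dots> \<le> 1 * (\<mu> * (X * b1 k))" using \<kappa> \<mu> X p by (intro mult_right_mono) auto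
      finally show ?thesis using x1k by simp
    qed
    define xX where "xX = xA + y k * x1"
    have dX: "decomposes z \<tau> (\<lambda>d. fA k d + y k * f1 k (d - sg k)) xX"
      unfolding xX_def using p by (intro decomposes.add dA decomposes_scale_shift d1) simp
    have xXk: "xX \<le> \<mu> * (X * \<kappa> * (al k + y k * b1 k))"
    proof -
      have "y k * x1 \<le> y k * (\<mu> * (X * b1 k))" using x1m p by (intro mult_left_mono) auto
      then have "xX \<le> X * (al k + \<mu> * (y k * b1 k))"
        using xA by (simp add: xX_def X_def algebra_simps)
      also have "y k * b1 k \<le> Y * ((1 + Y) * al k)"
        using b1_le[of k] yY p Y_ge_1 by (intro mult_mono) auto
      then have "al k + \<mu> * (y k * b1 k) \<le> \<mu> * (\<kappa> * (al k + y k * b1 k))"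
        using p by (intro mix) (auto simp: mult_ac)
      then have "X * (al k + \<mu> * (y k * b1 k)) \<le> X * (\<mu> * (\<kappa> * (al k + y k * b1 k)))"
        using X by (intro mult_left_mono) auto
      finally show ?thesis by (simp add: mult_ac)
    qed
    define xA' where "xA' = xA + \<kappa>0 * (1 + y k) * x1"
    have dA': "decomposes z \<tau> (fA (Suc k)) xA'"
      using decomposes.add[OF dA decomposes_step[OF d1, of k]]
      by (simp add: f_Suc[abs_def] xA'_def \<kappa>0_def add.assoc)
    have "xA' \<le> X * \<kappa> * al (Suc k)"
    proof -
      have "\<kappa>0 * (1 + y k) * x1 \<le> \<kappa>0 * (1 + y k) * (\<mu> * (X * b1 k))"
        using x1m p \<kappa>0 by (intro mult_left_mono) auto
      then have "xA' \<le> X * (al k + \<kappa>0 * \<mu> * ((1 + y k) * b1 k))"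
        using xA by (simp add: xA'_def X_def algebra_simps)
      also have "al k + \<kappa>0 * \<mu> * ((1 + y k) * b1 k) \<le> \<kappa> * al (Suc k)"
      proof -
        define b where "b = (1 + y k) * b1 k"
        have b: "al k \<le> b" using al_le_b1[of k] p by (simp add: b_def algebra_simps add_increasing2)
        have "\<gamma> * al k \<le> \<gamma> * b" using b \<gamma> by (intro mult_left_mono) auto
        moreover have "2 * \<gamma> * b \<le> (1 - \<kappa>0 * \<mu>) * b" using \<gamma> b p by (intro mult_right_mono) auto
        ultimately have "al k + \<kappa>0 * \<mu> * b \<le> \<kappa> * (al k + b)" by (simp add: \<kappa>_def algebra_simps)
        then show ?thesis by (simp add: weight_Suc b_def)
      qed
      finally show ?thesis using X by (simp add: mult_ac)
    qed
    then have xA': "xA' \<le> \<kappa> ^ Suc k * al (Suc k)" by (simp add: X_def mult_ac)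
    show ?case
    proof (cases "fl k")
      case True
      have "decomposes z \<tau> (fB (Suc k)) xX" using dX True by (simp add: f_Suc[abs_def])
      moreover have "xX \<le> \<mu> * (\<kappa> ^ Suc k * be (Suc k))"
        using xXk True by (simp add: weight_Suc X_def mult_ac)
      ultimately show ?thesis using dA' xA' by blast
    next
      case False
      have "decomposes z \<tau> (fB (Suc k)) x1" using d1 False by (simp add: f_Suc[abs_def])
      moreover have "x1 \<le> \<mu> * (\<kappa> ^ Suc k * be (Suc k))"
        using x1k False by (simp add: weight_Suc X_def mult_ac)
      ultimately show ?thesis using dA' xA' by blast
    qed
  qed
  then show ?thesis using \<kappa> \<mu> by (intro exI[of _ \<kappa>] exI[of _ \<mu>]) auto
qed

lemma blocks_nearly_flat:
  assumes "0 < \<epsilon>"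
  shows "\<exists>\<kappa> C. 0 < \<kappa> \<and> \<kappa> < 1 \<and> 0 < C \<and>
    (\<forall>k. nearly_flat \<epsilon> (fA k) (C * \<kappa> ^ k * al k) \<and> nearly_flat \<epsilon> (fB k) (C * \<kappa> ^ k * be k))"
proof -
  obtain \<tau> C where \<tau>: "0 < \<tau>" "\<tau> < 1 + z" "0 < C"
    and bin: "\<And>m. nearly_flat \<epsilon> (binom_weight z m) (C * \<tau> ^ m)"
    using binom_weight_nearly_flat[OF z_pos assms] by blast
  obtain \<kappa> \<mu> where \<kappa>: "0 < \<kappa>" "\<kappa> < 1" "0 < \<mu>"
    and dec: "\<And>k. \<exists>xA xB. decomposes z \<tau> (fA k) xA \<and> decomposes z \<tau> (fB k) xB \<and>
       xA \<le> \<kappa> ^ k * al k \<and> xB \<le> \<mu> * (\<kappa> ^ k * be k)"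
    using decomposition_cost[OF \<tau>(1,2)] by blast
  define C' where "C' = C * max 1 \<mu>"
  have C': "C \<le> C'" "C * \<mu> \<le> C'" "0 < C'" using \<tau> by (auto simp: C'_def)
  have "nearly_flat \<epsilon> (fA k) (C' * \<kappa> ^ k * al k) \<and> nearly_flat \<epsilon> (fB k) (C' * \<kappa> ^ k * be k)" for k
  proof -
    obtain xA xB where d: "decomposes z \<tau> (fA k) xA" "decomposes z \<tau> (fB k) xB"
       and x: "xA \<le> \<kappa> ^ k * al k" "xB \<le> \<mu> * (\<kappa> ^ k * be k)" using dec by blast
    have w: "0 \<le> \<kappa> ^ k * al k" "0 \<le> \<kappa> ^ k * be k" using weight_pos[of k] \<kappa> by auto
    have "C * xA \<le> C * (\<kappa> ^ k * al k)" using x \<tau> by (intro mult_left_mono) auto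
    also have "\<dots> \<le> C' * (\<kappa> ^ k * al k)" using C' w by (intro mult_right_mono) auto
    finally have A: "C * xA \<le> C' * \<kappa> ^ k * al k" by (simp add: mult_ac)
    have "C * xB \<le> C * (\<mu> * (\<kappa> ^ k * be k))" using x \<tau> by (intro mult_left_mono) auto
    also have "\<dots> = C * \<mu> * (\<kappa> ^ k * be k)" by simp
    also have "\<dots> \<le> C' * (\<kappa> ^ k * be k)" using C' w by (intro mult_right_mono) auto
    finally have B: "C * xB \<le> C' * \<kappa> ^ k * be k" by (simp add: mult_ac)
    show ?thesis
      using nearly_flat_mono[OF decomposes_nearly_flat[OF d(1) bin] A]
        nearly_flat_mono[OF decomposes_nearly_flat[OF d(2) bin] B] by blast
  qed
  then show ?thesis using \<kappa> C' by blast
qed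

text \<open>Chebyshev's inequality. Off the window, (x - d)^2 \<le> 2 * x^2 + 2 * d^2 makes
  \<open>g\<close> at least 1, and the second moment bounds the value of \<open>LA k\<close> at
  \<open>g\<close>.\<close>

lemma window_mass:
  assumes "0 < n"
  shows "al k * (1 - (2 * (4 * M + 4) * k + 2 * (real_of_int d)\<^sup>2) / (real n)\<^sup>2)
      \<le> (\<Sum>i\<in>{d - int n..d + int n}. fA k i)"
proof -
  let ?I = "{d - int n..d + int n}"
  let ?q = "\<lambda>x::int. (real_of_int x)\<^sup>2"
  define c where "c = (real n)\<^sup>2"
  have c: "0 < c" using assms by (simp add: c_def)
  define g where "g = (\<lambda>x::int. (2 / c) * ?q x + 2 * ?q d / c)"
  have sum: "(\<Sum>i\<in>?I. fA k i) = LA k (\<lambda>x. \<Sum>i\<in>?I. if x = i then 1 else 0)"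
    unfolding fA_def by (rule positive_linear_sum[symmetric, OF pl(1)]) simp
  have pt: "1 \<le> (\<Sum>i\<in>?I. if x = i then 1 else 0) + g x" for x
  proof (cases "x \<in> ?I")
    case True
    then show ?thesis using c by (auto simp: g_def)
  next
    case False
    have "real n \<le> \<bar>real_of_int x - real_of_int d\<bar>" using False by auto
    then have "c \<le> (real_of_int x - real_of_int d)\<^sup>2"
      unfolding c_def by (metis abs_of_nat power2_abs power_mono abs_ge_zero)
    also have "\<dots> \<le> 2 * ?q x + 2 * ?q d"
      using sum_squares_bound[of "real_of_int x" "- real_of_int d"]
      by (simp add: power2_eq_square algebra_simps)
    finally have "1 \<le> (2 * ?q x + 2 * ?q d) / c" using c by simp
    then have "1 \<le> g x" by (simp add: g_def add_divide_distrib)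
    then show ?thesis by (smt (verit) sum_nonneg)
  qed
  have "al k \<le> LA k (\<lambda>x. (\<Sum>i\<in>?I. if x = i then 1 else 0) + g x)"
    unfolding al_def by (rule positive_linear_mono[OF pl(1) pt])
  also have "\<dots> = (\<Sum>i\<in>?I. fA k i) + LA k g" by (simp add: positive_linearD(1)[OF pl(1)] sum)
  also have "LA k g = 2 / c * LA k ?q + 2 * ?q d / c * al k"
    unfolding g_def al_def
    using positive_linearD(1)[OF pl(1), of k "\<lambda>x. (2 / c) * ?q x" "\<lambda>_. 2 * ?q d / c"]
      positive_linearD(2)[OF pl(1), of k "2 / c" ?q] positive_linear_const[OF pl(1), of k "2 * ?q d / c"]
    by (simp only:)
  also have "2 / c * LA k ?q \<le> 2 / c * ((4 * M + 4) * k * al k)"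
    using second_moment[of k] c by (intro mult_left_mono) auto
  finally show ?thesis using c by (simp add: c_def[symmetric] field_simps)
qed

text \<open>One unit step at most doubles the value and adds x; the factor 2^(m + 1) - 1 solves u' =
  2 * u + 1 with u = 1 at distance 0.\<close>

lemma doubling_bound:
  fixes f :: "int \<Rightarrow> real"
  assumes flat: "nearly_flat 1 f x" and fd: "f d \<le> x" and n: "\<bar>i - d\<bar> \<le> int n" and x: "0 \<le> x"
  shows "f i \<le> 2 ^ (2 * n + 1) * x"
proof -
  have up: "f (d + int m) \<le> (2 ^ (m + 1) - 1) * x \<and> f (d - int m) \<le> (2 ^ (m + 1) - 1) * x" for m
  proof (induction m)
    case 0
    then show ?case using fd by simp
  next
    case (Suc m)
    have "f (d + int m + 1) \<le> 2 * f (d + int m) + x"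
         "f (d - int m - 1) \<le> 2 * f (d - int m) + x"
      using flat[unfolded nearly_flat_def, rule_format, of "d + int m"]
        flat[unfolded nearly_flat_def, rule_format, of "d - int m - 1"] by auto
    then show ?case using Suc by (simp add: algebra_simps)
  qed
  define m where "m = nat \<bar>i - d\<bar>"
  have m: "m \<le> n" "i = d + int m \<or> i = d - int m" using n by (auto simp: m_def)
  have "f i \<le> (2 ^ (m + 1) - 1) * x" using m(2) up[of m] by auto
  also have "(2::real) ^ (m + 1) \<le> 2 ^ (2 * n + 1)" using m(1) by (intro power_increasing) auto
  then have "((2::real) ^ (m + 1) - 1) * x \<le> 2 ^ (2 * n + 1) * x" using x by (intro mult_right_mono) linarith+
  finally show ?thesis .
qed

text \<open>Were the weight at d so small, the doubling bound would keep the whole window of radius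
  n = \<open>k div l\<close> light, of total weight at most about n * 4^n * q^k times the mass. But
  the second moment is of order k, hence of order n, so by Chebyshev that window holds at least half
  of the mass for large k.\<close>

lemma block_lower_bound:
  assumes \<kappa>: "0 < \<kappa>" "\<kappa> < 1" and C: "0 < C"
  shows "\<forall>\<^sub>F k in sequentially. C * \<kappa> ^ k * al k \<le> fA k d"
proof -
  obtain \<kappa>' C' where k': "0 < \<kappa>'" "\<kappa>' < 1" "0 < C'"
    and flat: "\<And>k. nearly_flat 1 (fA k) (C' * \<kappa>' ^ k * al k)"
    using blocks_nearly_flat[of 1] by auto
  define q where "q = max \<kappa> \<kappa>'"
  define B where "B = max C C'"
  have q: "0 < q" "q < 1" "\<kappa> \<le> q" "\<kappa>' \<le> q" using \<kappa> k' by (auto simp: q_def)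
  have B: "0 < B" "C \<le> B" "C' \<le> B" using C by (auto simp: B_def)
  \<comment> \<open>With q^k \<le> (1/16)^n, the factor 4^n from doubling is absorbed and (1/4)^n
    remains to beat the number of points in the window.\<close>
  obtain l where l: "q ^ l < 1 / 16" using real_arch_pow_inv[of "1/16" q] q by auto
  then have l0: "0 < l" by (cases l) auto
  define K where "K = (2 * (4 * M + 4)) * l"
  define E where "E = 2 * (real_of_int d)\<^sup>2"
  have lim1: "(\<lambda>n. (K * (real n + 1) + E) / (real n)\<^sup>2) \<longlonglongrightarrow> 0"
  proof -
    have "(\<lambda>n. (K + (K + E) * inverse (real n)) * inverse (real n)) \<longlonglongrightarrow> (K + (K + E) * 0) * 0"
      by (intro tendsto_intros lim_inverse_n)
    moreover have "\<forall>\<^sub>F n in sequentially. (K + (K + E) * inverse (real n)) * inverse (real n)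
        = (K * (real n + 1) + E) / (real n)\<^sup>2"
      using eventually_gt_at_top[of 0] by eventually_elim (simp add: field_simps power2_eq_square)
    ultimately show ?thesis by (simp add: filterlim_cong)
  qed
  have lim2: "(\<lambda>n. 6 * B * (real n * (1 / 4) ^ n) + 2 * B * (1 / 4) ^ n) \<longlonglongrightarrow> 6 * B * 0 + 2 * B * 0"
    by (intro tendsto_intros powser_times_n_limit_0 LIMSEQ_power_zero) auto
  have "\<forall>\<^sub>F n in sequentially. 0 < n \<and> (K * (real n + 1) + E) / (real n)\<^sup>2 < 1/2
      \<and> 6 * B * (real n * (1 / 4) ^ n) + 2 * B * (1 / 4) ^ n < 1/2"
    using order_tendstoD(2)[OF lim1, of "1/2"] order_tendstoD(2)[OF lim2, of "1/2"]
    by (intro eventually_conj eventually_gt_at_top) auto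
  moreover have "filterlim (\<lambda>k. k div l) at_top sequentially"
  proof (rule filterlim_at_top[THEN iffD2], intro allI)
    fix N
    show "\<forall>\<^sub>F k in sequentially. N \<le> k div l"
      using eventually_ge_at_top[of "N * l"]
      by eventually_elim (metis div_le_mono l0 nonzero_mult_div_cancel_right less_numeral_extra(3))
  qed
  ultimately have "\<forall>\<^sub>F k in sequentially. 0 < k div l \<and>
      (K * (real (k div l) + 1) + E) / (real (k div l))\<^sup>2 < 1/2
      \<and> 6 * B * (real (k div l) * (1 / 4) ^ (k div l)) + 2 * B * (1 / 4) ^ (k div l) < 1/2"
    by (rule eventually_compose_filterlim)
  then show ?thesis
  proof eventually_elim
    case (elim k)
    define n where "n = k div l"
    have n: "0 < n" "(K * (real n + 1) + E) / (real n)\<^sup>2 < 1/2"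
      "6 * B * (real n * (1 / 4) ^ n) + 2 * B * (1 / 4) ^ n < 1/2"
      using elim[folded n_def] by blast+
    have kl: "k \<le> l * (n + 1)" unfolding n_def using l0
      using dividend_less_times_div[of l k] by simp
    have M0: "0 \<le> M" using Y_ge_1 by (simp add: M_def D_def)
    have al: "0 < al k" by (rule weight_pos)
    show ?case
    proof (rule ccontr)
      assume neg: "\<not> ?thesis"
      define x where "x = B * q ^ k * al k"
      have "C' * \<kappa>' ^ k * al k \<le> x" "C * \<kappa> ^ k * al k \<le> x"
        unfolding x_def using B q k' \<kappa> C al by (auto intro!: mult_mono power_mono)
      then have fl1: "nearly_flat 1 (fA k) x" and fd: "fA k d \<le> x"
        using nearly_flat_mono[OF flat[of k]] neg by auto
      have x0: "0 \<le> x" using B q al by (simp add: x_def)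
      have "(\<Sum>i\<in>{d - int n..d + int n}. fA k i) \<le> (\<Sum>i\<in>{d - int n..d + int n}. 2 ^ (2 * n + 1) * x)"
        by (intro sum_mono doubling_bound[OF fl1 fd _ x0]) auto
      also have "\<dots> = (2 * real n + 1) * (2 * 4 ^ n) * (B * q ^ k) * al k"
        by (simp add: x_def power_mult)
      also have "\<dots> \<le> (2 * real n + 1) * (2 * 4 ^ n) * (B * (1/16) ^ n) * al k"
      proof -
        have "q ^ k \<le> q ^ (l * n)" using q by (intro power_decreasing) (auto simp: n_def)
        also have "\<dots> \<le> (1/16) ^ n" unfolding power_mult using q l by (intro power_mono) auto
        finally show ?thesis using B al by (intro mult_right_mono mult_left_mono) auto
      qed
      also have "\<dots> = (4 * B * (real n * (1 / 4) ^ n) + 2 * B * (1 / 4) ^ n) * al k"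
      proof -
        have "(4::real) ^ n * (1/16) ^ n = (1/4) ^ n" by (simp add: power_mult_distrib[symmetric])
        moreover have "(2 * real n + 1) * (2 * 4 ^ n) * (B * (1/16) ^ n) * al k
           = (4 * B * (real n * (4 ^ n * (1/16) ^ n)) + 2 * B * (4 ^ n * (1/16) ^ n)) * al k"
          by (simp add: algebra_simps)
        ultimately show ?thesis by simp
      qed
      also have "\<dots> < 1/2 * al k"
      proof -
        have "4 * B * (real n * (1 / 4) ^ n) \<le> 6 * B * (real n * (1 / 4) ^ n)"
          using B by (intro mult_right_mono) auto
        then show ?thesis using n(3) al by (intro mult_strict_right_mono) auto
      qed
      finally have small: "(\<Sum>i\<in>{d - int n..d + int n}. fA k i) < 1/2 * al k" .
      have "2 * (4 * M + 4) * real k \<le> K * (real n + 1)"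
      proof -
        have "real k \<le> real l * (real n + 1)" using kl by (metis of_nat_le_iff of_nat_mult of_nat_add of_nat_1)
        then show ?thesis unfolding K_def using M0
          by (metis (no_types, lifting) mult.assoc mult_left_mono add_nonneg_nonneg mult_nonneg_nonneg zero_le_numeral)
      qed
      then have "(2 * (4 * M + 4) * real k + E) / (real n)\<^sup>2 \<le> (K * (real n + 1) + E) / (real n)\<^sup>2"
        by (intro divide_right_mono) auto
      then have "1/2 \<le> 1 - (2 * (4 * M + 4) * real k + E) / (real n)\<^sup>2" using n(2) by linarith
      then have "al k * (1/2) \<le> al k * (1 - (2 * (4 * M + 4) * real k + E) / (real n)\<^sup>2)"
        using al by (intro mult_left_mono) auto
      with window_mass[OF n(1), of k d] small show False unfolding E_def by linarith
    qed
  qed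
qed

end

section \<open>Partial quotients and badly approximable numbers\<close>

lemma complete_quotient_irrational:
  assumes "x \<notin> \<rat>"
  shows "complete_quotient x n \<notin> \<rat>"
proof (induction n)
  case 0
  then show ?case using assms by simp
next
  case (Suc n)
  show ?case
  proof
    assume "complete_quotient x (Suc n) \<in> \<rat>"
    then have "1 / complete_quotient x (Suc n) \<in> \<rat>" by (rule Rats_divide[OF Rats_1])
    then have "frac (complete_quotient x n) + of_int \<lfloor>complete_quotient x n\<rfloor> \<in> \<rat>"
      by (intro Rats_add Rats_of_int) simp
    then show False using Suc by (simp add: frac_def)
  qed
qed

lemma complete_quotient_gt_1:
  assumes "x \<notin> \<rat>"
  shows "1 < complete_quotient x (Suc n)"
proof -
  let ?y = "complete_quotient x n"
  have "?y \<notin> \<int>" using complete_quotient_irrational[OF assms, of n] Ints_subset_Rats by blast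
  then have "0 < frac ?y" by simp
  then show ?thesis using frac_lt_1[of ?y] by simp
qed

text \<open>P / Q and P' / Q' are consecutive convergents, starting from \<lfloor>x\<rfloor> / 1 and
  the formal 1 / 0; the induction substitutes y = a + 1 / y'.\<close>

lemma convergent_exists:
  fixes x :: real
  assumes irr: "x \<notin> \<rat>"
  shows "\<exists>(P::int) (Q::int) (P'::int) (Q'::int). 0 < Q \<and> 0 \<le> Q' \<and> \<bar>P' * Q - P * Q'\<bar> = 1 \<and>
     x * (real_of_int Q * complete_quotient x (Suc n) + real_of_int Q')
       = real_of_int P * complete_quotient x (Suc n) + real_of_int P'"
proof (induction n)
  case 0
  have "x \<notin> \<int>" using irr Ints_subset_Rats by blast
  then have "frac x \<noteq> 0" by simp
  then have "x * (1 / frac x) = \<lfloor>x\<rfloor> * (1 / frac x) + 1" by (simp add: field_simps frac_def)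
  then show ?case by (intro exI[of _ "\<lfloor>x\<rfloor>"] exI[of _ 1] exI[of _ 1] exI[of _ 0]) simp
next
  case (Suc n)
  define y where "y = complete_quotient x (Suc n)"
  define y' where "y' = complete_quotient x (Suc (Suc n))"
  obtain P Q P' Q' :: int where Q: "0 < Q" "0 \<le> Q'" and det: "\<bar>P' * Q - P * Q'\<bar> = 1"
    and e: "x * (Q * y + Q') = P * y + P'"
    using Suc unfolding y_def by blast
  define a where "a = \<lfloor>y\<rfloor>"
  have y'1: "1 < y'" unfolding y'_def by (rule complete_quotient_gt_1[OF irr])
  have "y' = 1 / frac y" by (simp add: y'_def y_def)
  then have "frac y = 1 / y'" using y'1 by auto
  then have ya: "y = a + 1 / y'" by (simp add: frac_def a_def)
  have a: "1 \<le> a" using complete_quotient_gt_1[OF irr, of n] by (simp add: a_def y_def le_floor_iff)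
  have t: "y * y' = a * y' + 1" using y'1 unfolding ya by (simp add: field_simps)
  have "x * (Q * y + Q') * y' = (P * y + P') * y'" by (simp only: e)
  then have "x * (Q * (y * y') + Q' * y') = P * (y * y') + P' * y'" by (simp add: algebra_simps)
  then have "x * ((Q * a + Q') * y' + Q) = (P * a + P') * y' + P"
    unfolding t by (simp add: algebra_simps)
  moreover have "0 < Q * a + Q'" using Q a by (intro add_pos_nonneg mult_pos_pos) auto
  moreover have "\<bar>P * (Q * a + Q') - (P * a + P') * Q\<bar> = 1" using det by (simp add: algebra_simps)
  ultimately show ?case
    using Q unfolding y'_def[symmetric]
    by (intro exI[of _ "P * a + P'"] exI[of _ "Q * a + Q'"] exI[of _ P] exI[of _ Q]) simp
qed

text \<open>The determinant gives \<bar>Q * x - P\<bar> * (Q * y + Q') = 1 for the complete quotient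
  y, so bad approximability by P / Q forces y \<le> 1 / c. The integer part of x itself is not
  reached by this, hence the \<open>max\<close>.\<close>

lemma bounded_type_if_badly_approximable:
  fixes x c :: real
  assumes irr: "x \<notin> \<rat>" and c: "0 < c"
    and bad: "\<And>(q::int) (p::int). 0 < q \<Longrightarrow> c \<le> real_of_int q * \<bar>real_of_int q * x - real_of_int p\<bar>"
  shows "bounded_type x"
  unfolding bounded_type_def
proof (intro conjI irr exI allI)
  fix n
  show "\<bar>partial_quotient x n\<bar> \<le> max \<bar>\<lfloor>x\<rfloor>\<bar> \<lceil>1 / c\<rceil>"
  proof (cases n)
    case 0
    then show ?thesis by (simp add: partial_quotient_def)
  next
    case (Suc m)
    define y where "y = complete_quotient x (Suc m)"
    obtain P Q P' Q' :: int where Q: "0 < Q" "0 \<le> Q'" and det: "\<bar>P' * Q - P * Q'\<bar> = 1"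
      and e: "x * (Q * y + Q') = P * y + P'"
      using convergent_exists[OF irr] unfolding y_def by blast
    have y1: "1 < y" unfolding y_def by (rule complete_quotient_gt_1[OF irr])
    have N: "0 < Q * y" "0 < Q * y + Q'" using Q y1 by (auto intro: add_pos_nonneg)
    have "(Q * x - P) * (Q * y + Q') = Q * (x * (Q * y + Q')) - P * (Q * y + Q')"
      by (simp add: algebra_simps)
    also have "\<dots> = of_int (P' * Q - P * Q')" unfolding e by (simp add: algebra_simps)
    finally have "\<bar>(Q * x - P) * (Q * y + Q')\<bar> = 1"
      using det by (metis of_int_1 of_int_abs)
    then have one: "\<bar>Q * x - P\<bar> * (Q * y + Q') = 1" using N by (simp add: abs_mult)
    have "c * (Q * y) \<le> c * (Q * y + Q')" using c Q by (intro mult_left_mono) auto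
    also have "\<dots> \<le> Q * \<bar>Q * x - P\<bar> * (Q * y + Q')"
      using bad[OF Q(1), of P] N by (intro mult_right_mono) auto
    also have "\<dots> = Q" using one by simp
    finally have "(c * y) * real_of_int Q \<le> 1 * real_of_int Q" by (simp add: mult_ac)
    then have "c * y \<le> 1" by (rule mult_right_le_imp_le) (use Q in simp)
    then have "y \<le> 1 / c" using c by (simp add: field_simps)
    then have "\<lfloor>y\<rfloor> \<le> \<lceil>1 / c\<rceil>" by linarith
    moreover have "0 \<le> \<lfloor>y\<rfloor>" using y1 by simp
    ultimately show ?thesis unfolding partial_quotient_def Suc y_def[symmetric] by simp
  qed
qed

text \<open>At t = j * \<alpha> this turns the counting condition into the parity of \<lfloor>j *
  \<beta>\<rfloor>.\<close>

lemma frac_less_half_iff: "frac t < 1 / 2 \<longleftrightarrow> even \<lfloor>2 * t\<rfloor>" for t :: real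
proof -
  define m where "m = \<lfloor>t\<rfloor>"
  define f where "f = frac t"
  have t: "t = of_int m + f" and f: "0 \<le> f" "f < 1"
    unfolding m_def f_def using frac_ge_0[of t] frac_lt_1[of t] by (simp_all add: frac_def)
  have "\<lfloor>2 * t\<rfloor> = (if f < 1 / 2 then 2 * m else 2 * m + 1)"
    using f by (intro floor_unique) (auto simp: t)
  then show ?thesis by (simp add: f_def)
qed

section \<open>The walk of a badly approximable slope\<close>

text \<open>A move by \<delta> crosses no integer if none is nearer than \<bar>\<delta>\<bar>. The
  case of equality occurs in the application, at j = Q, and is settled by
  \<open>nint\<close>.\<close>

lemma floor_add_small:
  fixes x \<delta> :: real
  assumes gap: "\<And>m::int. \<bar>\<delta>\<bar> \<le> \<bar>x - m\<bar>" and nint: "x + \<delta> \<notin> \<int>"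
  shows "\<lfloor>x + \<delta>\<rfloor> = \<lfloor>x\<rfloor>"
proof -
  have "x + \<delta> \<noteq> of_int (\<lfloor>x\<rfloor> + 1)" using nint by (metis Ints_of_int)
  moreover have "\<bar>\<delta>\<bar> \<le> of_int (\<lfloor>x\<rfloor> + 1) - x" using gap[of "\<lfloor>x\<rfloor> + 1"] floor_correct[of x] by auto
  moreover have "\<bar>\<delta>\<bar> \<le> x - \<lfloor>x\<rfloor>" using gap[of "\<lfloor>x\<rfloor>"] floor_correct[of x] by auto
  ultimately show ?thesis using floor_correct[of x] by (intro floor_unique) auto
qed

lemma floor_minus_nonint: "x \<notin> \<int> \<Longrightarrow> \<lfloor>- x\<rfloor> = - 1 - \<lfloor>x\<rfloor>" for x :: real
proof -
  assume "x \<notin> \<int>"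
  then have "x \<noteq> of_int \<lfloor>x\<rfloor>" by (metis Ints_of_int)
  then have "of_int \<lfloor>x\<rfloor> < x" "x < of_int \<lfloor>x\<rfloor> + 1" using floor_correct[of x] by linarith+
  moreover have "real_of_int (- 1 - \<lfloor>x\<rfloor>) = - 1 - of_int \<lfloor>x\<rfloor>" by simp
  ultimately show ?thesis by (intro floor_unique) linarith+
qed

definition alternating :: "int \<Rightarrow> int" where
  "alternating m = (if even m then 1 else - 1)"

lemma alternating_add: "alternating (a + b) = alternating a * alternating b"
  by (simp add: alternating_def)

lemma alternating_diff: "alternating (a - b) = alternating a * alternating b"
  by (simp add: alternating_def)

text \<open>Write (j, m) = a * (Q, P) + b * (Q', P') with integers a, b. The range of j excludes
  that both are positive or both nonpositive. As the two errors have opposite signs too, a *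
  \<delta> and b * \<delta>' do not cancel, and the one with positive coefficient already gives the
  bound.\<close>

lemma lattice_gap:
  fixes \<beta> :: real and Q Q' j :: nat and P P' m :: int
  assumes det: "\<bar>P' * int Q - P * int Q'\<bar> = 1"
    and opp: "(Q * \<beta> - P) * (Q' * \<beta> - P') < 0"
    and j: "0 < j" "j < Q + Q'"
  shows "\<bar>Q * \<beta> - P\<bar> \<le> \<bar>j * \<beta> - m\<bar> \<or> \<bar>Q' * \<beta> - P'\<bar> \<le> \<bar>j * \<beta> - m\<bar>"
proof -
  \<comment> \<open>Since e is its own inverse, Cramer's rule yields integral coordinates a and
    b.\<close>
  define e where "e = P' * int Q - P * int Q'"
  have "e = 1 \<or> e = -1" unfolding e_def using det by linarith
  then have e: "e * e = 1" by auto
  define a where "a = e * (int j * P' - m * int Q')"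
  define b where "b = e * (m * int Q - int j * P)"
  have ab: "a * Q + b * Q' = int j" "a * P + b * P' = m"
  proof -
    have "a * Q + b * Q' = (e * e) * int j" "a * P + b * P' = (e * e) * m"
      by (simp_all add: a_def b_def e_def algebra_simps)
    then show "a * Q + b * Q' = int j" "a * P + b * P' = m" using e by simp_all
  qed
  define \<delta> where "\<delta> = Q * \<beta> - P"
  define \<delta>' where "\<delta>' = Q' * \<beta> - P'"
  have lin: "j * \<beta> - m = a * \<delta> + b * \<delta>'"
  proof -
    have "real j = a * Q + b * Q'" "real_of_int m = a * P + b * P'"
      using ab by (metis of_int_add of_int_mult of_int_of_nat_eq)+
    then show ?thesis by (simp add: \<delta>_def \<delta>'_def algebra_simps)
  qed
  have opp': "(0 < \<delta> \<and> \<delta>' < 0) \<or> (\<delta> < 0 \<and> 0 < \<delta>')"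
    using opp by (auto simp: \<delta>_def \<delta>'_def mult_less_0_iff)
  consider "1 \<le> a" "1 \<le> b" | "1 \<le> a" "b \<le> 0" | "a \<le> 0" "1 \<le> b" | "a \<le> 0" "b \<le> 0" by linarith
  then show ?thesis
  proof cases
    case 1
    have "1 * int Q + 1 * int Q' \<le> a * Q + b * Q'" using 1 by (intro add_mono mult_right_mono) auto
    then show ?thesis using ab j by auto
  next
    case 2
    then have r: "1 \<le> real_of_int a" "real_of_int b \<le> 0" by auto
    have "\<bar>\<delta>\<bar> \<le> \<bar>a * \<delta> + b * \<delta>'\<bar>"
      using opp'
    proof
      assume s: "0 < \<delta> \<and> \<delta>' < 0"
      have "1 * \<delta> \<le> a * \<delta>" "0 \<le> b * \<delta>'" using s r by (auto intro!: mult_right_mono mult_nonpos_nonpos)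
      then show ?thesis using s by linarith
    next
      assume s: "\<delta> < 0 \<and> 0 < \<delta>'"
      have "a * \<delta> \<le> 1 * \<delta>" "b * \<delta>' \<le> 0" using s r by (auto intro!: mult_right_mono_neg mult_nonpos_nonneg)
      then show ?thesis using s by linarith
    qed
    then show ?thesis by (simp add: lin \<delta>_def)
  next
    case 3
    then have r: "1 \<le> real_of_int b" "real_of_int a \<le> 0" by auto
    have "\<bar>\<delta>'\<bar> \<le> \<bar>a * \<delta> + b * \<delta>'\<bar>"
      using opp'
    proof
      assume s: "0 < \<delta> \<and> \<delta>' < 0"
      have "b * \<delta>' \<le> 1 * \<delta>'" "a * \<delta> \<le> 0" using s r by (auto intro!: mult_right_mono_neg mult_nonpos_nonneg)
      then show ?thesis using s by linarith
    next
      assume s: "\<delta> < 0 \<and> 0 < \<delta>'"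
      have "1 * \<delta>' \<le> b * \<delta>'" "0 \<le> a * \<delta>" using s r by (auto intro!: mult_right_mono mult_nonpos_nonpos)
      then show ?thesis using s by linarith
    qed
    then show ?thesis by (simp add: lin \<delta>'_def)
  next
    case 4
    have "a * Q + b * Q' \<le> 0" using 4 by (simp add: mult_nonpos_nonneg add_nonpos_nonpos)
    then show ?thesis using ab j by auto
  qed
qed

text \<open>
  One step appends the partial quotients \<open>1, 2\<close> to the continued fraction if the direction is kept,
  and \<open>1, 1, 1\<close> if it is reversed.
\<close>

primrec block_vec :: "(nat \<Rightarrow> bool) \<Rightarrow> 'a::comm_semiring_1 \<Rightarrow> 'a \<Rightarrow> nat \<Rightarrow> 'a \<times> 'a" where
  "block_vec fl a b 0 = (a, b)"
| "block_vec fl a b (Suc k) =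
    (let (a', b') = block_vec fl a b k
     in (3 * a' + 2 * b', if fl k then 2 * a' + b' else a' + b'))"

locale block_lengths =
  fixes fl :: "nat \<Rightarrow> bool"
begin

primrec sig :: "nat \<Rightarrow> int" where
  "sig 0 = 1"
| "sig (Suc k) = (if fl k then - sig k else sig k)"

definition qA :: "nat \<Rightarrow> nat" where "qA k = fst (block_vec fl 1 1 k)"
definition qB :: "nat \<Rightarrow> nat" where "qB k = snd (block_vec fl 1 1 k)"
definition pA :: "nat \<Rightarrow> int" where "pA k = fst (block_vec fl 0 1 k)"
definition pB :: "nat \<Rightarrow> int" where "pB k = snd (block_vec fl 0 1 k)"

lemma block_0: "qA 0 = 1" "qB 0 = 1" "pA 0 = 0" "pB 0 = 1"
  by (simp_all add: qA_def qB_def pA_def pB_def)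

lemma block_Suc:
  "qA (Suc k) = 3 * qA k + 2 * qB k"
  "qB (Suc k) = (if fl k then 2 * qA k + qB k else qA k + qB k)"
  "pA (Suc k) = 3 * pA k + 2 * pB k"
  "pB (Suc k) = (if fl k then 2 * pA k + pB k else pA k + pB k)"
  by (simp_all add: qA_def qB_def pA_def pB_def split: prod.splits)

lemma sig_cases: "sig k = 1 \<or> sig k = -1"
  by (induction k) auto

lemma q_bounds: "0 < qA k \<and> 0 < qB k \<and> k \<le> qB k \<and> qB k \<le> qA k \<and> k < qA k"
  by (induction k) (auto simp: block_0 block_Suc)

lemma qA_Suc_le: "qA (Suc k) \<le> 5 * qA k"
  using q_bounds[of k] by (simp add: block_Suc)

lemma parity: "even (pA k) \<and> odd (pB k)"
  by (induction k) (auto simp: block_0 block_Suc)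

text \<open>The matrix of a step has determinant 1 if the direction is kept and -1 if it is
  reversed. So \<open>sig\<close> also tells on which side of pB / qB the fraction pA / qA
  lies.\<close>

lemma det: "pB k * int (qA k) - pA k * int (qB k) = sig k"
proof (induction k)
  case (Suc k)
  then show ?case by (cases "fl k") (simp_all add: block_Suc algebra_simps)
qed (simp add: block_0)

text \<open>Nested intervals: the new fractions are weighted mediants of the old ones, hence
  strictly between them. This strictness keeps the limit off all endpoints.\<close>

lemma slope_exists:
  "\<exists>\<beta>::real. \<forall>k. 0 < sig k * (qA k * \<beta> - pA k) \<and> sig k * (qB k * \<beta> - pB k) < 0"
proof -
  define xA where "xA k = real_of_int (pA k) / qA k" for k
  define xB where "xB k = real_of_int (pB k) / qB k" for k
  define lo where "lo k = (if sig k = 1 then xA k else xB k)" for k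
  define hi where "hi k = (if sig k = 1 then xB k else xA k)" for k
  have q: "0 < real (qA k)" "0 < real (qB k)" for k using q_bounds[of k] by auto
  have detr: "pB k * real (qA k) - pA k * real (qB k) = sig k" for k
    using arg_cong[OF det[of k], of real_of_int] by simp
  have lohi: "lo k < hi k" for k
    using detr[of k] q[of k] sig_cases[of k]
    by (auto simp: lo_def hi_def xA_def xB_def field_simps)
  have between: "lo k < (m * real_of_int (pA k) + n * pB k) / (m * qA k + n * qB k) \<and>
      (m * real_of_int (pA k) + n * pB k) / (m * qA k + n * qB k) < hi k"
    if "0 < m" "0 < n" for m n :: real and k
  proof -
    have N: "0 < m * qA k + n * qB k" using that q[of k] by (intro add_pos_pos mult_pos_pos)
    have "n * (pB k * real (qA k)) - n * (pA k * real (qB k)) = n * sig k"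
         "m * (pB k * real (qA k)) - m * (pA k * real (qB k)) = m * sig k"
      using detr[of k] by (metis right_diff_distrib)+
    then show ?thesis
      using N q[of k] sig_cases[of k] that
      by (auto simp: lo_def hi_def xA_def xB_def pos_less_divide_eq pos_divide_less_eq
          divide_less_eq less_divide_eq algebra_simps)
  qed
  have btw: "lo k < xA (Suc k) \<and> xA (Suc k) < hi k \<and> lo k < xB (Suc k) \<and> xB (Suc k) < hi k" for k
    using between[of 3 2 k] between[of 2 1 k] between[of 1 1 k]
    by (auto simp: xA_def xB_def block_Suc)
  have lo_step: "lo k < lo (Suc k)" and hi_step: "hi (Suc k) < hi k" for k
    using btw[of k] by (auto simp: lo_def hi_def[of "Suc k"] lo_def[of "Suc k"])
  have inc: "lo i \<le> lo j" if "i \<le> j" for i j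
    using that lo_step by (metis lift_Suc_mono_le less_imp_le)
  have dec: "hi j \<le> hi i" if "i \<le> j" for i j
    using that hi_step by (metis lift_Suc_antimono_le less_imp_le)
  have cross: "lo i \<le> hi j" for i j
    using inc[of i "max i j"] dec[of j "max i j"] lohi[of "max i j"] by auto
  define \<beta> where "\<beta> = (SUP i. lo i)"
  have "lo i \<le> \<beta>" for i
    unfolding \<beta>_def using cross[of _ 0] by (intro cSUP_upper bdd_aboveI2) auto
  moreover have "\<beta> \<le> hi j" for j
    unfolding \<beta>_def using cross by (intro cSUP_least) auto
  ultimately have b: "lo k < \<beta>" "\<beta> < hi k" for k
    using lo_step[of k] hi_step[of k] by (meson less_le_trans le_less_trans)+
  have "0 < sig k * (qA k * \<beta> - pA k) \<and> sig k * (qB k * \<beta> - pB k) < 0" for k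
    using b[of k] q[of k] sig_cases[of k]
    by (auto simp: lo_def hi_def xA_def xB_def field_simps)
  then show ?thesis by blast
qed

end

locale slope = block_lengths fl for fl :: "nat \<Rightarrow> bool" +
  fixes \<beta> :: real
  assumes A_side: "0 < sig k * (qA k * \<beta> - pA k)"
    and B_side: "sig k * (qB k * \<beta> - pB k) < 0"
begin

definition dA :: "nat \<Rightarrow> real" where "dA k = qA k * \<beta> - pA k"
definition dB :: "nat \<Rightarrow> real" where "dB k = qB k * \<beta> - pB k"

abbreviation q1 :: "nat \<Rightarrow> nat" where "q1 k \<equiv> qA k + qB k"
abbreviation p1 :: "nat \<Rightarrow> int" where "p1 k \<equiv> pA k + pB k"
abbreviation d1 :: "nat \<Rightarrow> real" where "d1 k \<equiv> dA k + dB k"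

text \<open>The last two signs come from level \<open>Suc k\<close>: the new \<open>dA\<close> is
  \<open>dA\<close> + 2 * \<open>d1\<close>, and the new \<open>dB\<close> is \<open>d1\<close> or
  \<open>dA\<close> + \<open>d1\<close> according to the direction. In both cases they determine the
  signs of \<open>d1\<close> and of \<open>dA\<close> + \<open>d1\<close>.\<close>

lemma d_signs:
  "0 < sig k * dA k" "sig k * dB k < 0" "sig k * d1 k < 0" "0 < sig k * (dA k + d1 k)"
proof -
  show A: "0 < sig k * dA k" and B: "sig k * dB k < 0"
    using A_side[of k] B_side[of k] by (simp_all add: dA_def dB_def)
  have s: "sig (Suc k) = (if fl k then - sig k else sig k)" by simp
  have A': "dA (Suc k) = 3 * dA k + 2 * dB k"
    and B': "dB (Suc k) = (if fl k then 2 * dA k + dB k else d1 k)"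
    by (simp_all add: dA_def dB_def block_Suc algebra_simps)
  have "0 < sig (Suc k) * dA (Suc k)" "sig (Suc k) * dB (Suc k) < 0"
    using A_side[of "Suc k"] B_side[of "Suc k"] by (simp_all add: dA_def dB_def)
  then show "sig k * d1 k < 0" "0 < sig k * (dA k + d1 k)"
    using A B sig_cases[of k] unfolding s A' B' by (auto split: if_splits)
qed

lemma d_abs: "\<bar>d1 k\<bar> \<le> \<bar>dA k\<bar>" "\<bar>dA k\<bar> \<le> \<bar>dB k\<bar>" "\<bar>dB k\<bar> \<le> 2 * \<bar>dA k\<bar>"
  using d_signs[of k] sig_cases[of k] by auto

lemma d_det: "\<bar>dA k\<bar> * qB k + \<bar>dB k\<bar> * qA k = 1"
proof -
  have "pB k * real (qA k) - pA k * real (qB k) = sig k"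
    using arg_cong[OF det[of k], of real_of_int] by simp
  then have "dA k * qB k - dB k * qA k = sig k" by (simp add: dA_def dB_def algebra_simps)
  then show ?thesis using d_signs(1,2)[of k] sig_cases[of k] by auto
qed

lemma dA_lt_1: "\<bar>dA k\<bar> < 1"
proof -
  have "dB k \<noteq> 0" using d_signs(2)[of k] by auto
  then have "0 < \<bar>dB k\<bar> * qA k" using q_bounds[of k] by simp
  moreover have "\<bar>dA k\<bar> * 1 \<le> \<bar>dA k\<bar> * qB k" using q_bounds[of k] by (intro mult_left_mono) auto
  ultimately show ?thesis using d_det[of k] by linarith
qed

lemma dA_lower: "1 \<le> 3 * qA k * \<bar>dA k\<bar>"
proof -
  have "\<bar>dA k\<bar> * qB k \<le> \<bar>dA k\<bar> * qA k" "\<bar>dB k\<bar> * qA k \<le> (2 * \<bar>dA k\<bar>) * qA k"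
    using q_bounds[of k] d_abs[of k] by (auto intro!: mult_left_mono mult_right_mono)
  then show ?thesis using d_det[of k] by (simp add: algebra_simps)
qed

text \<open>A denominator b would force \<bar>dA k\<bar> \<ge> 1 / b at every level, whereas
  \<bar>dA k\<bar> * qB k < 1 and qB k \<ge> k.\<close>

lemma irrational: "\<beta> \<notin> \<rat>"
proof
  assume "\<beta> \<in> \<rat>"
  then obtain a b :: int where b: "0 < b" and ab: "\<beta> = a / b"
    by (rule Rats_cases') auto
  define k where "k = nat b"
  define w where "w = qA k * a - pA k * b"
  have w: "b * dA k = of_int w" unfolding dA_def using b by (simp add: w_def ab field_simps)
  moreover have "b * dA k \<noteq> 0" using d_signs(1)[of k] b by auto
  ultimately have "1 \<le> \<bar>w\<bar>" by auto
  then have "1 \<le> \<bar>b * dA k\<bar>" unfolding w by (metis of_int_1_le_iff of_int_abs)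
  then have "1 \<le> \<bar>dA k\<bar> * b" using b by (simp add: abs_mult mult.commute)
  also have "\<dots> \<le> \<bar>dA k\<bar> * qB k" using q_bounds[of k] b
    by (intro mult_left_mono) (auto simp: k_def)
  finally have "\<bar>dB k\<bar> * qA k \<le> 0" using d_det[of k] by linarith
  moreover have "dB k \<noteq> 0" using d_signs(2)[of k] by auto
  then have "0 < \<bar>dB k\<bar> * qA k" using q_bounds[of k] by simp
  ultimately show False by linarith
qed

lemma multiple_not_int: "0 < j \<Longrightarrow> real j * \<beta> - of_int m \<notin> \<int>"
proof
  assume j: "0 < j" and int: "real j * \<beta> - of_int m \<in> \<int>"
  from int obtain n where "real j * \<beta> - of_int m = of_int n" by (rule Ints_cases)
  then have "\<beta> = of_int (n + m) / of_int (int j)" using j by (simp add: field_simps)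
  then have "\<beta> \<in> \<rat>" by (metis Rats_divide Rats_of_int)
  then show False using irrational by simp
qed

definition step_sign :: "nat \<Rightarrow> int" where "step_sign j = alternating \<lfloor>real j * \<beta>\<rfloor>"
text \<open>The term j = 0, always 1, is left out so that the walk starts at 0 and full blocks are
  exactly (anti)symmetric. It returns as the summand 1 in
  \<open>discrepancy_half_slope\<close>.\<close>

definition S :: "nat \<Rightarrow> int" where "S N = (\<Sum>j\<in>{1..N}. step_sign j)"

lemma S_0: "S 0 = 0" by (simp add: S_def)
lemma S_Suc: "S (Suc N) = S N + step_sign (Suc N)" by (simp add: S_def)

lemma step_sign_shift:
  assumes gap: "\<And>m::int. \<bar>Q * \<beta> - P\<bar> \<le> \<bar>j * \<beta> - m\<bar>" and j: "0 < j"
  shows "step_sign (j + Q) = alternating P * step_sign j"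
proof -
  have "real j * \<beta> + (Q * \<beta> - of_int P) \<notin> \<int>"
    using multiple_not_int[of "j + Q" P] j by (simp add: algebra_simps)
  from floor_add_small[OF gap this] have "\<lfloor>j * \<beta> + (Q * \<beta> - P)\<rfloor> = \<lfloor>j * \<beta>\<rfloor>" .
  then have "\<lfloor>real (j + Q) * \<beta>\<rfloor> = P + \<lfloor>j * \<beta>\<rfloor>"
    by (simp add: algebra_simps)
  then show ?thesis by (simp add: step_sign_def alternating_add)
qed

text \<open>Negating a non-integer gives \<lfloor>- x\<rfloor> = - 1 - \<lfloor>x\<rfloor>, whence
  the extra sign compared to the shift rule: an even numerator makes the steps antisymmetric and the
  walk symmetric, an odd one does the opposite.\<close>

lemma step_sign_reflect:
  assumes gap: "\<And>m::int. \<bar>Q * \<beta> - P\<bar> \<le> \<bar>j * \<beta> - m\<bar>" and j: "0 < j" "j < Q"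
  shows "step_sign (Q - j) = - alternating P * step_sign j"
proof -
  have gap': "\<bar>Q * \<beta> - P\<bar> \<le> \<bar>- (j * \<beta>) - m\<bar>" for m :: int
    using gap[of "- m"] by (simp add: abs_if split: if_splits)
  have "- (real j * \<beta>) + (Q * \<beta> - of_int P) \<notin> \<int>"
    using multiple_not_int[of "Q - j" P] j by (simp add: algebra_simps of_nat_diff)
  from floor_add_small[OF gap' this] have "\<lfloor>- (j * \<beta>) + (Q * \<beta> - P)\<rfloor> = \<lfloor>- (j * \<beta>)\<rfloor>" .
  also have "\<dots> = - 1 - \<lfloor>j * \<beta>\<rfloor>"
    using multiple_not_int[of j 0] j by (intro floor_minus_nonint) auto
  finally have "\<lfloor>real (Q - j) * \<beta>\<rfloor> = P - (1 + \<lfloor>j * \<beta>\<rfloor>)"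
    using j by (simp add: algebra_simps of_nat_diff) linarith
  then show ?thesis by (simp add: step_sign_def alternating_diff alternating_add) (simp add: alternating_def)
qed

lemma gap_A: "0 < j \<Longrightarrow> j < q1 k \<Longrightarrow> \<bar>qA k * \<beta> - pA k\<bar> \<le> \<bar>j * \<beta> - of_int m\<bar>"
proof -
  assume j: "0 < j" "j < q1 k"
  have "\<bar>pB k * int (qA k) - pA k * int (qB k)\<bar> = 1" using det[of k] sig_cases[of k] by auto
  moreover have "(qA k * \<beta> - pA k) * (qB k * \<beta> - pB k) < 0"
    using d_signs(1,2)[of k] sig_cases[of k] by (auto simp: dA_def dB_def mult_less_0_iff)
  ultimately show ?thesis
    using lattice_gap[of "pB k" "qA k" "pA k" "qB k" \<beta> j m] j d_abs(2)[of k]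
    by (auto simp: dA_def dB_def)
qed

text \<open>The basis is now (qA, pA), (q1, p1). It extends the range of j beyond that of
  \<open>gap_A\<close>, just far enough for the sign-reversed copy to reach the end 2 * q1 + qA of
  the next even block.\<close>

lemma gap_1: "0 < j \<Longrightarrow> j < qA k + q1 k \<Longrightarrow> \<bar>q1 k * \<beta> - p1 k\<bar> \<le> \<bar>j * \<beta> - of_int m\<bar>"
proof -
  assume j: "0 < j" "j < qA k + q1 k"
  have e: "q1 k * \<beta> - p1 k = d1 k" by (simp add: dA_def dB_def algebra_simps)
  have "\<bar>p1 k * int (qA k) - pA k * int (q1 k)\<bar> = 1"
    using det[of k] sig_cases[of k] by (auto simp: algebra_simps)
  moreover have "(qA k * \<beta> - pA k) * (q1 k * \<beta> - p1 k) < 0"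
    unfolding e using d_signs(1,3)[of k] sig_cases[of k]
    by (auto simp: dA_def[symmetric] mult_less_0_iff)
  ultimately show ?thesis
    using lattice_gap[of "p1 k" "qA k" "pA k" "q1 k" \<beta> j m] j d_abs(1)[of k]
    unfolding e by (auto simp: dA_def[symmetric])
qed

lemma alternating_p: "alternating (pA k) = 1" "alternating (p1 k) = -1"
  using parity[of k] by (auto simp: alternating_def)

lemma S_add_qA: "N < q1 k \<Longrightarrow> S (qA k + N) = S (qA k) + S N"
proof (induction N)
  case (Suc N)
  have "step_sign (Suc N + qA k) = step_sign (Suc N)"
    using step_sign_shift[OF gap_A[of "Suc N" k]] Suc.prems by (simp add: alternating_p)
  then show ?case using Suc by (simp add: S_Suc add.commute)
qed (simp add: S_0)

lemma S_add_q1: "N < qA k + q1 k \<Longrightarrow> S (q1 k + N) = S (q1 k) - S N"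
proof (induction N)
  case (Suc N)
  have "step_sign (Suc N + q1 k) = - step_sign (Suc N)"
    using step_sign_shift[OF gap_1[of "Suc N" k]] Suc.prems by (simp add: alternating_p)
  then have "step_sign (Suc (q1 k + N)) = - step_sign (Suc N)" by (simp add: add.commute)
  then show ?case using Suc by (simp add: S_Suc)
qed (simp add: S_0)

lemma S_reflect:
  assumes sgn: "\<And>j. 0 < j \<Longrightarrow> j < Q \<Longrightarrow> step_sign (Q - j) = c * step_sign j" and N: "N < Q"
  shows "S (Q - 1 - N) = S (Q - 1) - c * S N"
  using N
proof (induction N)
  case (Suc N)
  have e: "Q - 1 - N = Suc (Q - 1 - Suc N)" using Suc.prems by simp
  have "step_sign (Suc (Q - 1 - Suc N)) = c * step_sign (Suc N)"
    using sgn[of "Suc N"] Suc.prems by (metis (no_types, lifting) Suc_diff_Suc diff_Suc_1 diff_commute diff_diff_left plus_1_eq_Suc zero_less_Suc)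
  then show ?case using Suc e by (simp add: S_Suc algebra_simps)
qed (simp add: S_0)

text \<open>At N = qA - 1 the reflection reads 0 = 2 * S (qA - 1), so its constant vanishes.\<close>

lemma S_reflect_A: "N < qA k \<Longrightarrow> S (qA k - 1 - N) = S N"
proof -
  have r: "S (qA k - 1 - N) = S (qA k - 1) + S N" if "N < qA k" for N
    using S_reflect[of "qA k" "-1" N] that step_sign_reflect[OF gap_A[of _ k]]
    by (simp add: alternating_p)
  have "S (qA k - 1) = 0" using r[of "qA k - 1"] q_bounds[of k] by (simp add: S_0)
  then show "N < qA k \<Longrightarrow> S (qA k - 1 - N) = S N" using r by simp
qed

lemma S_reflect_q1: "N < q1 k \<Longrightarrow> S (q1 k - 1 - N) = S (q1 k - 1) - S N"
  using S_reflect[of "q1 k" 1 N] step_sign_reflect[OF gap_1[of _ k]]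
  by (simp add: alternating_p)

lemma S_qA: "S (qA k) = sig k"
proof -
  have "S (qA k - 1) = 0"
    using S_reflect_A[of 0 k] q_bounds[of k] by (simp add: S_0)
  then have "S (qA k) = step_sign (qA k)"
    using S_Suc[of "qA k - 1"] q_bounds[of k] by simp
  also have "\<dots> = sig k"
    using sig_cases[of k]
  proof
    assume s: "sig k = 1"
    then have "\<lfloor>qA k * \<beta>\<rfloor> = pA k"
      using d_signs(1)[of k] dA_lt_1[of k] by (intro floor_unique) (auto simp: dA_def)
    then show ?thesis using s parity[of k] by (simp add: step_sign_def alternating_def)
  next
    assume s: "sig k = -1"
    then have "\<lfloor>qA k * \<beta>\<rfloor> = pA k - 1"
      using d_signs(1)[of k] dA_lt_1[of k] by (intro floor_unique) (auto simp: dA_def)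
    then show ?thesis using s parity[of k] by (simp add: step_sign_def alternating_def)
  qed
  finally show ?thesis .
qed

text \<open>The last step of the odd block also goes in direction \<open>sig k\<close>: compared to
  \<open>S_qA\<close> both the side of the approximation and the parity of the numerator change, and
  the two effects cancel.\<close>

lemma S_q1: "S (q1 k) = S (q1 k - 1) + sig k"
proof -
  have e: "q1 k * \<beta> = p1 k + d1 k" by (simp add: dA_def dB_def algebra_simps)
  have lt: "\<bar>d1 k\<bar> < 1" using d_abs(1)[of k] dA_lt_1[of k] by linarith
  have "S (q1 k) = S (q1 k - 1) + step_sign (q1 k)"
    using S_Suc[of "q1 k - 1"] q_bounds[of k] by simp
  also have "step_sign (q1 k) = sig k"
    using sig_cases[of k]
  proof
    assume s: "sig k = 1"
    then have "\<lfloor>p1 k + d1 k\<rfloor> = p1 k - 1"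
      using d_signs(3)[of k] lt by (intro floor_unique) auto
    then show ?thesis using s parity[of k] unfolding step_sign_def e by (simp add: alternating_def)
  next
    assume s: "sig k = -1"
    then have "\<lfloor>p1 k + d1 k\<rfloor> = p1 k"
      using d_signs(3)[of k] lt by (intro floor_unique) auto
    then show ?thesis using s parity[of k] unfolding step_sign_def e by (simp add: alternating_def)
  qed
  finally show ?thesis .
qed

lemma S_after_qA: "N < q1 k \<Longrightarrow> S (qA k + N) = sig k + S N"
  by (simp add: S_add_qA S_qA)

text \<open>S (q1 + N) = S q1 - S N, and antisymmetry replaces - S N by S (q1 - 1 - N) - S (q1 - 1);
  of the constants only the last step of the block survives.\<close>

lemma S_after_q1: "N < q1 k \<Longrightarrow> S (q1 k + N) = sig k + S (q1 k - 1 - N)"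
  by (simp only: S_reflect_q1 S_add_q1 S_q1)

lemma S_after_2q1: "N < qA k \<Longrightarrow> S (2 * q1 k + N) = S N"
proof -
  assume N: "N < qA k"
  have "S (2 * q1 k + N) = S (q1 k + (q1 k + N))" by (simp only: mult_2 add.assoc)
  also have "\<dots> = S N" using S_add_q1[of "q1 k + N" k] S_add_q1[of N k] N by simp
  finally show ?thesis .
qed

text \<open>For the first k with j < qA k, the distance is at least \<bar>dA k\<bar> \<ge> 1 / (3 *
  qA k), while minimality of k gives qA k \<le> 5 * j.\<close>

lemma badly_approximable: "0 < j \<Longrightarrow> 1 \<le> 15 * real j * \<bar>real j * \<beta> - of_int m\<bar>"
proof -
  assume j: "0 < j"
  define k where "k = (LEAST k. j < qA k)"
  have "j < qA k" unfolding k_def by (rule LeastI[of "\<lambda>k. j < qA k" j]) (simp add: q_bounds)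
  then have gap: "\<bar>dA k\<bar> \<le> \<bar>real j * \<beta> - of_int m\<bar>"
    using gap_A[of j k m] j by (simp add: dA_def)
  have "qA k \<le> 5 * j"
  proof (cases k)
    case 0
    then show ?thesis using j by (simp add: block_0)
  next
    case (Suc i)
    then have "\<not> j < qA i" using not_less_Least[of i "\<lambda>k. j < qA k"] by (simp add: k_def)
    then show ?thesis using qA_Suc_le[of i] Suc by simp
  qed
  then have "3 * real (qA k) \<le> 15 * real j" by linarith
  then have "3 * real (qA k) * \<bar>dA k\<bar> \<le> (15 * real j) * \<bar>real j * \<beta> - of_int m\<bar>"
    by (rule mult_mono[OF _ gap]) auto
  then show ?thesis using dA_lower[of k] by linarith
qed

section \<open>Weighted visit counts of time segments\<close>

definition tilted_visits :: "real \<Rightarrow> nat \<Rightarrow> nat \<Rightarrow> int \<Rightarrow> real" where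
  "tilted_visits z a b d = (\<Sum>N\<in>{a..<b}. if S N = d then z powi d else 0)"

lemma tilted_visits_concat:
  "a \<le> b \<Longrightarrow> b \<le> c \<Longrightarrow>
    tilted_visits z a c d = tilted_visits z a b d + tilted_visits z b c d"
  unfolding tilted_visits_def by (rule sum.atLeastLessThan_concat[symmetric])

lemma tilted_visits_shift:
  assumes "\<And>N. a \<le> N \<Longrightarrow> N < b \<Longrightarrow> S (c + N) = s + S N" and "0 < z"
  shows "tilted_visits z (c + a) (c + b) d = z powi s * tilted_visits z a b (d - s)"
proof -
  have "tilted_visits z (c + a) (c + b) d = (\<Sum>N\<in>{a..<b}. if S (c + N) = d then z powi d else 0)"
    unfolding tilted_visits_def
    using sum.shift_bounds_nat_ivl[of "\<lambda>N. if S N = d then z powi d else 0" a c b]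
    by (simp add: add.commute)
  also have "\<dots> = (\<Sum>N\<in>{a..<b}. z powi s * (if S N = d - s then z powi (d - s) else 0))"
  proof (rule sum.cong[OF refl])
    fix N assume "N \<in> {a..<b}"
    moreover have "z powi d = z powi s * z powi (d - s)"
      using assms(2) by (simp add: power_int_add[symmetric])
    ultimately show "(if S (c + N) = d then z powi d else 0)
        = z powi s * (if S N = d - s then z powi (d - s) else 0)"
      using assms(1)[of N] by auto
  qed
  also have "\<dots> = z powi s * tilted_visits z a b (d - s)"
    by (simp add: tilted_visits_def sum_distrib_left)
  finally show ?thesis .
qed

text \<open>A prefix of a copy run backwards is a suffix of the original, which is why suffixes have
  to be controlled along with prefixes.\<close>

lemma tilted_visits_reflect:
  assumes "\<And>N. N < n \<Longrightarrow> S (c + N) = s + S (q - 1 - N)" and "n \<le> q" and "0 < z"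
  shows "tilted_visits z c (c + n) d = z powi s * tilted_visits z (q - n) q (d - s)"
proof -
  have "tilted_visits z c (c + n) d = (\<Sum>N\<in>{0..<n}. if S (c + N) = d then z powi d else 0)"
    unfolding tilted_visits_def
    using sum.shift_bounds_nat_ivl[of "\<lambda>N. if S N = d then z powi d else 0" 0 c n]
    by (simp add: add.commute)
  also have "\<dots> = (\<Sum>N\<in>{q - n..<q}. z powi s * (if S N = d - s then z powi (d - s) else 0))"
  proof (rule sum.reindex_bij_witness[where i = "\<lambda>N. q - 1 - N" and j = "\<lambda>N. q - 1 - N"])
    fix N assume N: "N \<in> {0..<n}"
    have "z powi d = z powi s * z powi (d - s)"
      using assms(3) by (simp add: power_int_add[symmetric])
    then show "z powi s * (if S (q - 1 - N) = d - s then z powi (d - s) else 0)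
        = (if S (c + N) = d then z powi d else 0)"
      using assms(1)[of N] N by auto
  qed (use assms(2) in auto)
  also have "\<dots> = z powi s * tilted_visits z (q - n) q (d - s)"
    by (simp add: tilted_visits_def sum_distrib_left)
  finally show ?thesis .
qed

lemma visits_after_qA:
  assumes "0 < z" "b \<le> q1 k"
  shows "tilted_visits z (qA k + a) (qA k + b) d = z powi sig k * tilted_visits z a b (d - sig k)"
proof (rule tilted_visits_shift)
  fix N assume "N < b"
  then show "S (qA k + N) = sig k + S N" using assms(2) by (intro S_after_qA) simp
qed (rule assms(1))

lemma visits_after_q1:
  assumes "0 < z" "n \<le> q1 k"
  shows "tilted_visits z (q1 k) (q1 k + n) d
       = z powi sig k * tilted_visits z (q1 k - n) (q1 k) (d - sig k)"
proof (rule tilted_visits_reflect)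
  fix N assume "N < n"
  then show "S (q1 k + N) = sig k + S (q1 k - 1 - N)" using assms(2) by (intro S_after_q1) simp
qed (fact assms)+

lemma visits_after_2q1:
  assumes "0 < z" "n \<le> qA k"
  shows "tilted_visits z (2 * q1 k) (2 * q1 k + n) d = tilted_visits z 0 n d"
proof -
  have "tilted_visits z (2 * q1 k + 0) (2 * q1 k + n) d = z powi 0 * tilted_visits z 0 n (d - 0)"
  proof (rule tilted_visits_shift)
    fix N assume "N < n"
    then show "S (2 * q1 k + N) = 0 + S N" using assms(2) by (simp only: S_after_2q1 add_0)
  qed (rule assms(1))
  then show ?thesis by (simp only: power_int_0_right mult_1 diff_0_right add_0_right)
qed

lemma visits_suffix_A:
  assumes "0 < z" "n \<le> qA k"
  shows "tilted_visits z (qA k - n) (qA k) d = tilted_visits z 0 n d"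
proof -
  have "tilted_visits z 0 (0 + n) d = z powi 0 * tilted_visits z (qA k - n) (qA k) (d - 0)"
  proof (rule tilted_visits_reflect)
    fix N assume "N < n"
    then show "S (0 + N) = 0 + S (qA k - 1 - N)" using assms(2) by (simp only: S_reflect_A add_0)
  qed (fact assms)+
  then show ?thesis by (simp only: power_int_0_right mult_1 diff_0_right add_0)
qed

lemma half_slope_irrational: "\<beta> / 2 \<notin> \<rat>"
proof
  assume "\<beta> / 2 \<in> \<rat>"
  then have "2 * (\<beta> / 2) \<in> \<rat>" by (intro Rats_mult) auto
  then show False using irrational by simp
qed

text \<open>Approximating \<beta> / 2 by p / q is approximating \<beta> by 2 * p / q, with half the
  distance; hence 30 = 2 * 15.\<close>

lemma half_slope_bounded_type: "bounded_type (\<beta> / 2)"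
proof (rule bounded_type_if_badly_approximable[OF half_slope_irrational, of "1 / 30"])
  fix q p :: int assume q: "0 < q"
  have "1 \<le> 15 * real (nat q) * \<bar>real (nat q) * \<beta> - of_int (2 * p)\<bar>"
    using q by (intro badly_approximable) simp
  also have "\<bar>real (nat q) * \<beta> - of_int (2 * p)\<bar> = 2 * \<bar>q * (\<beta> / 2) - p\<bar>"
    using q by (simp add: abs_if)
  finally show "1 / 30 \<le> real_of_int q * \<bar>real_of_int q * (\<beta> / 2) - real_of_int p\<bar>" using q by simp
qed simp

lemma discrepancy_half_slope: "discrepancy (\<beta> / 2) (Suc N) = (1 + of_int (S N)) / 2"
proof -
  have c: "real (card {j. j < n \<and> frac (real j * (\<beta> / 2)) \<in> {0..<1/2}}) - real n / 2
      = (\<Sum>j<n. of_int (step_sign j)) / 2" for n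
  proof (induction n)
    case 0
    then show ?case by simp
  next
    case (Suc n)
    let ?P = "\<lambda>j. frac (real j * (\<beta> / 2)) \<in> {0..<1/2}"
    have P: "?P n \<longleftrightarrow> even \<lfloor>real n * \<beta>\<rfloor>"
      using frac_less_half_iff[of "real n * (\<beta> / 2)"] frac_ge_0[of "real n * (\<beta> / 2)"] by simp
    have "{j. j < Suc n \<and> ?P j} = (if ?P n then insert n {j. j < n \<and> ?P j} else {j. j < n \<and> ?P j})"
      using less_Suc_eq by (auto split: if_splits)
    then have "card {j. j < Suc n \<and> ?P j} = card {j. j < n \<and> ?P j} + (if ?P n then 1 else 0)"
      by simp
    then show ?case using Suc P by (simp add: step_sign_def alternating_def field_simps)
  qed
  have "(\<Sum>j<Suc n. step_sign j) = 1 + S n" for n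
    by (induction n) (simp_all add: S_0 S_Suc step_sign_def alternating_def)
  then have "(\<Sum>j<Suc N. of_int (step_sign j)) = (1 + of_int (S N) :: real)"
    by (metis of_int_1 of_int_add of_int_sum)
  then show ?thesis unfolding discrepancy_def c by simp
qed

lemma visits_half_slope:
  assumes "0 < z"
  shows "real (visits (discrepancy (\<beta> / 2)) (of_int m / 2) n)
       = tilted_visits z 0 n (m - 1) / z powi (m - 1)"
proof -
  have "discrepancy (\<beta> / 2) N = of_int m / 2 \<longleftrightarrow> S (N - 1) = m - 1" if "1 \<le> N" for N
  proof -
    have "discrepancy (\<beta> / 2) N = (1 + of_int (S (N - 1))) / 2"
      using discrepancy_half_slope[of "N - 1"] that by simp
    then show ?thesis by (auto simp: field_simps)
  qed
  then have "{N \<in> {1..n}. discrepancy (\<beta> / 2) N = of_int m / 2} = {N \<in> {1..n}. S (N - 1) = m - 1}"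
    by auto
  also have "\<dots> = Suc ` {N \<in> {0..<n}. S N = m - 1}"
    by (auto simp: image_iff) (metis One_nat_def Suc_le_D diff_Suc_1 less_eq_Suc_le)
  finally have "visits (discrepancy (\<beta> / 2)) (of_int m / 2) n = card {N \<in> {0..<n}. S N = m - 1}"
    unfolding visits_def by (simp add: card_image)
  moreover have "tilted_visits z 0 n d = real (card {N \<in> {0..<n}. S N = d}) * z powi d" for d
    unfolding tilted_visits_def by (simp add: sum.If_cases Int_def conj_commute)
  ultimately show ?thesis using assms by simp
qed

end

section \<open>Prefixes of the walk\<close>

text \<open>Joins the two constructions: the continued fraction of \<beta> is steered by the
  directions \<open>fl\<close> of the formal recursion.\<close>

locale tilted_walk = tilt z + slope "tilt.fl z" \<beta> for z \<beta> :: real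
begin

lemma sig_eq: "sig k = sg k"
  by (induction k) (simp_all add: step_0 step_Suc)

text \<open>Cutting the next even block at q1 and 2 * q1 yields \<open>f1\<close>, its weighted
  shift and \<open>fA\<close>, the three terms of the recursion. The next odd block is either the
  first of these pieces or \<open>A\<close> followed by a shifted \<open>f1\<close>.\<close>

lemma visits_blocks:
  "tilted_visits z 0 (qA k) = fA k" "tilted_visits z 0 (qB k) = fB k" "tilted_visits z 0 (q1 k) = f1 k"
proof -
  have one: "tilted_visits z 0 (q1 k) d = f1 k d"
    if "\<And>d. tilted_visits z 0 (qA k) d = fA k d" "\<And>d. tilted_visits z 0 (qB k) d = fB k d" for k d
    using visits_after_qA[OF z_pos, of "qB k" k 0 d] tilted_visits_concat[of 0 "qA k" "q1 k" z d] that
    by (simp add: f1_def sig_eq y_def)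
  have "(\<forall>d. tilted_visits z 0 (qA k) d = fA k d) \<and> (\<forall>d. tilted_visits z 0 (qB k) d = fB k d)" for k
  proof (induction k)
    case 0
    then show ?case by (auto simp: tilted_visits_def block_0 f_0 S_0)
  next
    case (Suc k)
    then have A: "tilted_visits z 0 (qA k) d = fA k d"
      and F: "tilted_visits z 0 (q1 k) d = f1 k d" for d using one by auto
    have "tilted_visits z (q1 k) (2 * q1 k) d = y k * f1 k (d - sg k)" for d
      using visits_after_q1[OF z_pos order_refl, of k d]
      by (simp only: F sig_eq y_def mult_2 diff_self_eq_0)
    moreover have "tilted_visits z (2 * q1 k) (qA (Suc k)) d = fA k d" for d
      using visits_after_2q1[OF z_pos order_refl, of k d] A by (simp add: block_Suc)
    ultimately have A': "tilted_visits z 0 (qA (Suc k)) d = fA (Suc k) d" for d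
      using tilted_visits_concat[of 0 "2 * q1 k" "qA (Suc k)" z d]
        tilted_visits_concat[of 0 "q1 k" "2 * q1 k" z d] F
      by (simp add: block_Suc f_Suc)
    have "tilted_visits z (qA k) (qA k + q1 k) d = y k * f1 k (d - sg k)" for d
      using visits_after_qA[OF z_pos order_refl, of k 0 d] F by (simp add: sig_eq y_def)
    then have "tilted_visits z 0 (qA k + q1 k) d = fA k d + y k * f1 k (d - sg k)" for d
      using tilted_visits_concat[of 0 "qA k" "qA k + q1 k" z d] A by simp
    then have "tilted_visits z 0 (qB (Suc k)) d = fB (Suc k) d" for d
      using F by (simp add: block_Suc f_Suc mult_2 add.assoc)
    then show ?case using A' by blast
  qed
  then show "tilted_visits z 0 (qA k) = fA k" "tilted_visits z 0 (qB k) = fB k"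
    "tilted_visits z 0 (q1 k) = f1 k" using one by auto
qed

text \<open>Bound on the share of either part of \<open>L1\<close>: the masses \<open>al\<close> and
  y * \<open>be\<close> are within a factor Y * R of each other.\<close>

definition \<theta> :: real where "\<theta> = Y * R / (1 + Y * R)"

lemma \<theta>_bounds: "0 < \<theta>" "\<theta> < 1"
proof -
  have "0 < R" by (simp add: R_def add_pos_nonneg)
  then have "0 < Y * R" using Y_ge_1 by simp
  then show "0 < \<theta>" "\<theta> < 1" by (simp_all add: \<theta>_def)
qed

lemma \<theta>_share: "al k \<le> \<theta> * b1 k" "y k * be k \<le> \<theta> * b1 k"
proof -
  have R1: "1 \<le> R" by (simp add: R_def)
  then have YR: "0 < 1 + Y * R" using Y_ge_1 by (simp add: add_pos_nonneg)
  have p: "0 < al k" "0 < be k" "0 < y k" using weight_pos y_pos by auto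
  have "al k \<le> R * be k" using weight_ratio by simp
  also have "\<dots> \<le> R * (be k * (Y * y k))"
    using y_bounds(2)[of k] p R1 by (intro mult_left_mono) auto
  finally have a: "al k \<le> (Y * R) * (y k * be k)" by (simp add: mult_ac)
  have "y k * be k \<le> Y * al k"
    using y_bounds(1)[of k] weight_ratio[of k] p Y_ge_1 by (intro mult_mono) auto
  also have "\<dots> \<le> (Y * al k) * R" using R1 p Y_ge_1 by simp
  finally have b: "y k * be k \<le> (Y * R) * al k" by (simp add: mult_ac)
  have "al k * (1 + Y * R) \<le> (Y * R) * b1 k" "(y k * be k) * (1 + Y * R) \<le> (Y * R) * b1 k"
    using a b by (simp_all add: b1_eq distrib_left mult_ac)
  then show "al k \<le> \<theta> * b1 k" "y k * be k \<le> \<theta> * b1 k"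
    using YR by (simp_all add: \<theta>_def pos_le_divide_eq)
qed

text \<open>Suffixes of \<open>B\<close> enter because the second copy of q1 is run backwards, so
  its prefixes consist of suffixes of \<open>A\<close> and \<open>B\<close>. For \<open>A\<close>
  the symmetry \<open>visits_suffix_A\<close> reduces suffixes to prefixes.\<close>

definition partial_blocks_flat :: "real \<Rightarrow> nat \<Rightarrow> real \<Rightarrow> bool" where
  "partial_blocks_flat \<epsilon> k x \<longleftrightarrow>
     (\<forall>n\<le>qA k. nearly_flat \<epsilon> (tilted_visits z 0 n) (x * al k)) \<and>
     (\<forall>n\<le>qB k. nearly_flat \<epsilon> (tilted_visits z 0 n) (x * be k)) \<and>
     (\<forall>n\<le>qB k. nearly_flat \<epsilon> (tilted_visits z (qB k - n) (qB k)) (x * be k))"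

text \<open>A cut hits only one piece of the block. The complete pieces have relative error e, and
  the cut piece, of relative error x, has at most the share \<theta> of the mass.\<close>

lemma partial_blocks_flat_step:
  assumes P: "partial_blocks_flat \<epsilon> k x" and x: "0 \<le> x" and e: "0 \<le> e"
    and A: "nearly_flat \<epsilon> (fA k) (e * al k)" and B: "nearly_flat \<epsilon> (fB k) (e * be k)"
  shows "partial_blocks_flat \<epsilon> (Suc k) (e + \<theta> * x)"
proof -
  have p: "0 < al k" "0 < b1 k" "0 < be k" "0 < y k" using weight_pos y_pos by auto
  have weaken: "nearly_flat \<epsilon> g c" if "g = f" "nearly_flat \<epsilon> f c'" "c' \<le> c" for f g c c'
    using nearly_flat_mono that by blast
  define x' where "x' = e + \<theta> * x"
  have x': "0 \<le> x'" "e \<le> x'" using x e \<theta>_bounds by (auto simp: x'_def)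
  have PA: "nearly_flat \<epsilon> (tilted_visits z 0 n) (x * al k)" if "n \<le> qA k" for n
    using P that by (simp add: partial_blocks_flat_def)
  have PB: "nearly_flat \<epsilon> (tilted_visits z 0 n) (x * be k)"
    "nearly_flat \<epsilon> (tilted_visits z (qB k - n) (qB k)) (x * be k)" if "n \<le> qB k" for n
    using P that by (auto simp: partial_blocks_flat_def)
  have shift: "nearly_flat \<epsilon> (\<lambda>d. y k * f (d - sg k)) (y k * c)" if "nearly_flat \<epsilon> f c" for f c
    using nearly_flat_scale_shift[OF that] p by simp
  have afterA: "tilted_visits z (qA k + a) (qA k + b) = (\<lambda>d. y k * tilted_visits z a b (d - sg k))"
    if "b \<le> q1 k" for a b
    using visits_after_qA[OF z_pos that] by (auto simp: sig_eq y_def)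
  have xal: "x * al k \<le> \<theta> * x * b1 k"
    using mult_left_mono[OF \<theta>_share(1)[of k] x] by (simp add: mult_ac)
  have xbe: "y k * (x * be k) \<le> \<theta> * x * b1 k"
    using mult_left_mono[OF \<theta>_share(2)[of k] x] by (simp add: mult_ac)
  have eb1: "e * al k + y k * (e * be k) = e * b1 k" by (simp add: b1_eq algebra_simps)
  have eal: "e * al k \<le> e * b1 k" using al_le_b1 e by (intro mult_left_mono)
  have ybe: "y k * (e * be k) \<le> e * b1 k" using eb1 e p by (metis add_increasing mult_nonneg_nonneg less_imp_le order_refl)
  have F1: "nearly_flat \<epsilon> (f1 k) (e * b1 k)"
    using nearly_flat_add[OF A shift[OF B]] by (simp add: f1_def[abs_def] eb1)
  have xx: "x' * b1 k = e * b1 k + \<theta> * x * b1 k" by (simp add: x'_def algebra_simps)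
  have nn: "0 \<le> e * b1 k" "0 \<le> \<theta> * x * b1 k" using e x p \<theta>_bounds by auto
  have pre1: "nearly_flat \<epsilon> (tilted_visits z 0 n) (x' * b1 k)" if n: "n \<le> q1 k" for n
  proof (cases "n \<le> qA k")
    case True
    have "x * al k \<le> x' * b1 k" using xal xx nn by linarith
    then show ?thesis using nearly_flat_mono[OF PA[OF True]] by blast
  next
    case False
    then obtain m where m: "n = qA k + m" "m \<le> qB k" using n
      by (metis add_le_cancel_left le_add_diff_inverse nat_le_linear)
    have "tilted_visits z 0 n = (\<lambda>d. fA k d + y k * tilted_visits z 0 m (d - sg k))"
      using tilted_visits_concat[of 0 "qA k" n z] afterA[of m 0] m by (auto simp: visits_blocks fun_eq_iff)
    moreover have "nearly_flat \<epsilon> \<dots> (e * al k + y k * (x * be k))"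
      using m by (intro nearly_flat_add A shift PB)
    moreover have "e * al k + y k * (x * be k) \<le> x' * b1 k" using eal xbe xx by linarith
    ultimately show ?thesis by (rule weaken)
  qed
  have suf1: "nearly_flat \<epsilon> (tilted_visits z (q1 k - n) (q1 k)) (x' * b1 k)" if n: "n \<le> q1 k" for n
  proof (cases "n \<le> qB k")
    case True
    then have "q1 k - n = qA k + (qB k - n)" by simp
    then have "tilted_visits z (q1 k - n) (q1 k) = (\<lambda>d. y k * tilted_visits z (qB k - n) (qB k) (d - sg k))"
      using afterA[of "qB k" "qB k - n"] by simp
    moreover have "nearly_flat \<epsilon> \<dots> (y k * (x * be k))"
      using True by (intro shift PB)
    moreover have "y k * (x * be k) \<le> x' * b1 k" using xbe xx nn by linarith
    ultimately show ?thesis by (rule weaken)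
  next
    case False
    then obtain m where m: "n = qB k + m" "m \<le> qA k" using n
      by (metis add.commute add_le_cancel_left le_add_diff_inverse nat_le_linear)
    then have e1: "q1 k - n = qA k - m" by simp
    have "tilted_visits z (q1 k - n) (q1 k) = (\<lambda>d. tilted_visits z 0 m d + y k * fB k (d - sg k))"
      using tilted_visits_concat[of "qA k - m" "qA k" "q1 k" z] afterA[of "qB k" 0]
        visits_suffix_A[OF z_pos m(2)] unfolding e1 by (auto simp: visits_blocks fun_eq_iff)
    moreover have "nearly_flat \<epsilon> \<dots> (x * al k + y k * (e * be k))"
      using m by (intro nearly_flat_add PA shift B)
    moreover have "x * al k + y k * (e * be k) \<le> x' * b1 k" using xal ybe xx by linarith
    ultimately show ?thesis by (rule weaken)
  qed
  have after1: "tilted_visits z (q1 k) (q1 k + n) = (\<lambda>d. y k * tilted_visits z (q1 k - n) (q1 k) (d - sg k))"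
    if "n \<le> q1 k" for n
    using visits_after_q1[OF z_pos that] by (auto simp: sig_eq y_def)
  have ex: "e * b1 k \<le> x' * b1 k" using x' p by (intro mult_right_mono) auto
  have alS: "x' * al (Suc k) = x' * al k + x' * b1 k + y k * (x' * b1 k)"
    by (simp add: weight_Suc algebra_simps)
  have beS: "x' * (al k + y k * b1 k) = x' * al k + y k * (x' * b1 k)" by (simp add: algebra_simps)
  have nn': "0 \<le> x' * al k" "0 \<le> x' * b1 k" "0 \<le> y k * (x' * b1 k)" using x' p by auto
  have yex: "y k * (e * b1 k) \<le> y k * (x' * b1 k)" using ex p by (intro mult_left_mono) auto
  have exl: "e * al k \<le> x' * al k" using x' p by (intro mult_right_mono) auto
  have "nearly_flat \<epsilon> (tilted_visits z 0 n) (x' * al (Suc k))" if n: "n \<le> qA (Suc k)" for n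
  proof -
    consider "n \<le> q1 k" | m where "n = q1 k + m" "m \<le> q1 k" | m where "n = 2 * q1 k + m" "m \<le> qA k"
    proof -
      have "n \<le> q1 k \<or> (n = q1 k + (n - q1 k) \<and> n - q1 k \<le> q1 k) \<or> (n = 2 * q1 k + (n - 2 * q1 k) \<and> n - 2 * q1 k \<le> qA k)"
        using n by (simp add: block_Suc) linarith
      then show ?thesis using that by blast
    qed
    then show ?thesis
    proof cases
      case 1
      have "x' * b1 k \<le> x' * al (Suc k)" using alS nn' by linarith
      then show ?thesis using nearly_flat_mono[OF pre1[OF 1]] by blast
    next
      case 2
      have "tilted_visits z 0 n = (\<lambda>d. f1 k d + y k * tilted_visits z (q1 k - m) (q1 k) (d - sg k))"
        using tilted_visits_concat[of 0 "q1 k" n z] after1[OF 2(2)] 2 by (auto simp: visits_blocks fun_eq_iff)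
      moreover have "nearly_flat \<epsilon> \<dots> (e * b1 k + y k * (x' * b1 k))"
        using 2 by (intro nearly_flat_add F1 shift suf1)
      moreover have "e * b1 k + y k * (x' * b1 k) \<le> x' * al (Suc k)" using ex alS nn' by linarith
      ultimately show ?thesis by (rule weaken)
    next
      case 3
      have two: "tilted_visits z (q1 k) (2 * q1 k) = (\<lambda>d. y k * f1 k (d - sg k))"
        using after1[OF order_refl] by (simp only: visits_blocks mult_2 diff_self_eq_0)
      have "tilted_visits z 0 n d = (f1 k d + y k * f1 k (d - sg k)) + tilted_visits z 0 m d" for d
      proof -
        have "tilted_visits z 0 n d = tilted_visits z 0 (q1 k) d + tilted_visits z (q1 k) (2 * q1 k) d
            + tilted_visits z (2 * q1 k) (2 * q1 k + m) d"
          using tilted_visits_concat[of 0 "q1 k" "2 * q1 k" z d] tilted_visits_concat[of 0 "2 * q1 k" n z d] 3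
          by simp
        then show ?thesis using visits_after_2q1[OF z_pos 3(2)] by (simp only: two visits_blocks)
      qed
      then have "tilted_visits z 0 n = (\<lambda>d. (f1 k d + y k * f1 k (d - sg k)) + tilted_visits z 0 m d)" by blast
      moreover have "nearly_flat \<epsilon> \<dots> ((e * b1 k + y k * (e * b1 k)) + x * al k)"
        using 3 by (intro nearly_flat_add F1 shift PA)
      moreover have "(e * b1 k + y k * (e * b1 k)) + x * al k \<le> x' * al (Suc k)"
        using yex alS nn' xal xx by linarith
      ultimately show ?thesis by (rule weaken)
    qed
  qed
  moreover have "nearly_flat \<epsilon> (tilted_visits z 0 n) (x' * be (Suc k)) \<and>
      nearly_flat \<epsilon> (tilted_visits z (qB (Suc k) - n) (qB (Suc k))) (x' * be (Suc k))"
    if n: "n \<le> qB (Suc k)" for n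
  proof (cases "fl k")
    case False
    then have eq: "qB (Suc k) = q1 k" "be (Suc k) = b1 k" by (simp_all add: block_Suc weight_Suc)
    show ?thesis using pre1 suf1 n unfolding eq by blast
  next
    case True
    then have eq: "qB (Suc k) = qA k + q1 k" "be (Suc k) = al k + y k * b1 k"
      by (simp_all add: block_Suc weight_Suc)
    \<comment> \<open>This makes \<open>LX\<close> at least as heavy as \<open>L1\<close>, so a cut
      \<open>A\<close> has share at most \<theta> here as well.\<close>
    have "be k \<le> b1 k" using weight_ratio[of k] al_le_b1[of k] by linarith
    then have "y k * be k \<le> y k * b1 k" using p by (intro mult_left_mono) auto
    then have "b1 k \<le> al k + y k * b1 k" by (simp add: b1_eq)
    then have "\<theta> * x * b1 k \<le> \<theta> * x * (al k + y k * b1 k)"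
      using x \<theta>_bounds by (intro mult_left_mono) auto
    with xal have xal': "x * al k \<le> \<theta> * x * (al k + y k * b1 k)" by linarith
    have xx': "x' * (al k + y k * b1 k) = e * al k + y k * (e * b1 k) + \<theta> * x * (al k + y k * b1 k)"
      by (simp add: x'_def algebra_simps)
    have en: "0 \<le> e * al k" "0 \<le> y k * (e * b1 k)" using assms(3) p by auto
    show ?thesis unfolding eq
    proof
      show "nearly_flat \<epsilon> (tilted_visits z 0 n) (x' * (al k + y k * b1 k))"
      proof (cases "n \<le> qA k")
        case True
        have "x * al k \<le> x' * (al k + y k * b1 k)" using xal' xx' en by linarith
        then show ?thesis using nearly_flat_mono[OF PA[OF True]] by blast
      next
        case False
        then obtain m where m: "n = qA k + m" "m \<le> q1 k"
          using n unfolding eq by (metis add_le_cancel_left le_add_diff_inverse nat_le_linear)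
        have "tilted_visits z 0 n = (\<lambda>d. fA k d + y k * tilted_visits z 0 m (d - sg k))"
          using tilted_visits_concat[of 0 "qA k" n z] afterA[of m 0] m by (auto simp: visits_blocks fun_eq_iff)
        moreover have "nearly_flat \<epsilon> \<dots> (e * al k + y k * (x' * b1 k))"
          using m by (intro nearly_flat_add A shift pre1)
        moreover have "e * al k + y k * (x' * b1 k) \<le> x' * (al k + y k * b1 k)" using beS exl by linarith
        ultimately show ?thesis by (rule weaken)
      qed
      show "nearly_flat \<epsilon> (tilted_visits z (qA k + q1 k - n) (qA k + q1 k)) (x' * (al k + y k * b1 k))"
      proof (cases "n \<le> q1 k")
        case True
        then have "qA k + q1 k - n = qA k + (q1 k - n)" by simp
        then have "tilted_visits z (qA k + q1 k - n) (qA k + q1 k)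
            = (\<lambda>d. y k * tilted_visits z (q1 k - n) (q1 k) (d - sg k))"
          using afterA[of "q1 k" "q1 k - n"] by simp
        moreover have "nearly_flat \<epsilon> \<dots> (y k * (x' * b1 k))"
          using True by (intro shift suf1)
        moreover have "y k * (x' * b1 k) \<le> x' * (al k + y k * b1 k)" using beS nn' by linarith
        ultimately show ?thesis by (rule weaken)
      next
        case False
        then obtain m where m: "n = q1 k + m" "m \<le> qA k"
          using n unfolding eq by (metis add.commute add_le_cancel_left le_add_diff_inverse nat_le_linear)
        then have e1: "qA k + q1 k - n = qA k - m" by simp
        have "tilted_visits z (qA k + q1 k - n) (qA k + q1 k)
            = (\<lambda>d. tilted_visits z 0 m d + y k * f1 k (d - sg k))"
          using tilted_visits_concat[of "qA k - m" "qA k" "qA k + q1 k" z] afterA[of "q1 k" 0]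
            visits_suffix_A[OF z_pos m(2)] unfolding e1 by (auto simp: visits_blocks fun_eq_iff)
        moreover have "nearly_flat \<epsilon> \<dots> (x * al k + y k * (e * b1 k))"
          using m by (intro nearly_flat_add PA shift F1)
        moreover have "x * al k + y k * (e * b1 k) \<le> x' * (al k + y k * b1 k)" using xal' xx' en by linarith
        ultimately show ?thesis by (rule weaken)
      qed
    qed
  qed
  ultimately show ?thesis unfolding partial_blocks_flat_def x'_def[symmetric] by blast
qed

text \<open>Solves x' = C0 * \<kappa>0^k + \<theta> * x by a geometric bound: C is such that C0 +
  \<theta> * C = C * (1 + \<theta>) / 2, and \<kappa> is at least (1 + \<theta>) / 2.\<close>

lemma prefix_nearly_flat:
  assumes \<epsilon>: "0 < \<epsilon>"
  shows "\<exists>\<kappa> C. 0 < \<kappa> \<and> \<kappa> < 1 \<and> 0 < C \<and>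
    (\<forall>k. \<forall>n\<le>qA k. nearly_flat \<epsilon> (tilted_visits z 0 n) (C * \<kappa> ^ k * al k))"
proof -
  obtain \<kappa>0 C0 where k0: "0 < \<kappa>0" "\<kappa>0 < 1" "0 < C0"
    and flat: "\<And>k. nearly_flat \<epsilon> (fA k) (C0 * \<kappa>0 ^ k * al k)"
      "\<And>k. nearly_flat \<epsilon> (fB k) (C0 * \<kappa>0 ^ k * be k)"
    using blocks_nearly_flat[OF \<epsilon>] by blast
  define \<kappa> where "\<kappa> = max \<kappa>0 ((1 + \<theta>) / 2)"
  define C where "C = 2 * C0 / (1 - \<theta>)"
  have \<kappa>: "0 < \<kappa>" "\<kappa> < 1" "\<kappa>0 \<le> \<kappa>" "(1 + \<theta>) / 2 \<le> \<kappa>"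
    using k0 \<theta>_bounds by (auto simp: \<kappa>_def)
  have C: "C * (1 - \<theta>) = 2 * C0" "C0 \<le> C" "0 < C"
    using k0 \<theta>_bounds by (auto simp: C_def field_simps)
  have "partial_blocks_flat \<epsilon> k (C * \<kappa> ^ k)" for k
  proof (induction k)
    case 0
    have empty: "tilted_visits z a a = (\<lambda>d. 0)" for a by (simp add: tilted_visits_def fun_eq_iff)
    have zero: "nearly_flat \<epsilon> (\<lambda>d. 0) C" using C by (simp add: nearly_flat_def)
    have "nearly_flat \<epsilon> (fA 0) C" using nearly_flat_mono[OF flat(1)[of 0]] C by (simp add: weight_0)
    then have one: "nearly_flat \<epsilon> (tilted_visits z 0 (Suc 0)) C"
      using visits_blocks(1)[of 0] by (simp add: block_0)
    show ?case
      unfolding partial_blocks_flat_def block_0 weight_0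
      using zero one by (auto simp: le_Suc_eq empty)
  next
    case (Suc k)
    have "partial_blocks_flat \<epsilon> (Suc k) (C0 * \<kappa>0 ^ k + \<theta> * (C * \<kappa> ^ k))"
      using Suc C k0 \<kappa> by (intro partial_blocks_flat_step flat) auto
    moreover have "C0 * \<kappa>0 ^ k + \<theta> * (C * \<kappa> ^ k) \<le> C * \<kappa> ^ Suc k"
    proof -
      have "C0 * \<kappa>0 ^ k \<le> C0 * \<kappa> ^ k" using k0 \<kappa> by (intro mult_left_mono power_mono) auto
      moreover have "C * ((1 + \<theta>) / 2) \<le> C * \<kappa>" using \<kappa> C by (intro mult_left_mono) auto
      then have "C0 + \<theta> * C \<le> C * \<kappa>" using C(1) by (simp add: algebra_simps)
      then have "(C0 + \<theta> * C) * \<kappa> ^ k \<le> (C * \<kappa>) * \<kappa> ^ k" using \<kappa> by (intro mult_right_mono) auto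
      ultimately show ?thesis by (simp add: algebra_simps)
    qed
    ultimately show ?case
      unfolding partial_blocks_flat_def
      using weight_pos[of "Suc k"]
      by (meson nearly_flat_mono mult_right_mono less_imp_le)
  qed
  then have "\<forall>k. \<forall>n\<le>qA k. nearly_flat \<epsilon> (tilted_visits z 0 n) (C * \<kappa> ^ k * al k)"
    by (simp add: partial_blocks_flat_def)
  then show ?thesis using \<kappa> C by blast
qed

lemma tilted_visits_mono: "m \<le> n \<Longrightarrow> tilted_visits z 0 m d \<le> tilted_visits z 0 n d"
  using z_pos unfolding tilted_visits_def by (intro sum_mono2) auto

text \<open>For qA k \<le> n < qA (Suc k), level \<open>Suc k\<close> bounds the additive error,
  while the complete block of level k inside the prefix bounds the visits from below. Masses of
  neighbouring levels differ by at most R, so B = C * R / \<epsilon> makes the error at most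
  \<epsilon> times the visits.\<close>

lemma eventually_ratio_close:
  assumes \<epsilon>: "0 < \<epsilon>"
  shows "\<forall>\<^sub>F n in sequentially. 0 < tilted_visits z 0 n d \<and>
    tilted_visits z 0 n (d + 1) \<le> (1 + 2 * \<epsilon>) * tilted_visits z 0 n d \<and>
    tilted_visits z 0 n d \<le> (1 + 2 * \<epsilon>) * tilted_visits z 0 n (d + 1)"
proof -
  obtain \<kappa> C where \<kappa>: "0 < \<kappa>" "\<kappa> < 1" and C: "0 < C"
    and flat: "\<And>k n. n \<le> qA k \<Longrightarrow> nearly_flat \<epsilon> (tilted_visits z 0 n) (C * \<kappa> ^ k * al k)"
    using prefix_nearly_flat[OF \<epsilon>] by blast
  define B where "B = C * R / \<epsilon>"
  have R: "0 < R" by (simp add: R_def add_pos_nonneg)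
  have B: "0 < B" using C R \<epsilon> by (simp add: B_def)
  have "\<forall>\<^sub>F k in sequentially. B * \<kappa> ^ k * al k \<le> fA k d \<and> B * \<kappa> ^ k * al k \<le> fA k (d + 1)"
    by (intro eventually_conj block_lower_bound \<kappa> B)
  then obtain K where K: "\<And>k. K \<le> k \<Longrightarrow> B * \<kappa> ^ k * al k \<le> fA k d \<and> B * \<kappa> ^ k * al k \<le> fA k (d + 1)"
    unfolding eventually_sequentially by blast
  show ?thesis
    using eventually_ge_at_top[of "qA K"]
  proof eventually_elim
    case (elim n)
    define l where "l = (LEAST l. n < qA l)"
    have nl: "n < qA l" unfolding l_def by (rule LeastI[of "\<lambda>l. n < qA l" n]) (simp add: q_bounds)
    have mono: "qA i \<le> qA j" if "i \<le> j" for i j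
      using that by (rule lift_Suc_mono_le[rotated]) (simp add: block_Suc)
    have "K < l" using mono[of l K] nl elim by (meson leD leI le_trans)
    then obtain k where l: "l = Suc k" "K \<le> k" by (cases l) auto
    have "\<not> n < qA k" using not_less_Least[of k "\<lambda>l. n < qA l"] l by (simp add: l_def)
    then have kn: "qA k \<le> n" by simp
    define x where "x = C * \<kappa> ^ l * al l"
    have nf: "nearly_flat \<epsilon> (tilted_visits z 0 n) x" unfolding x_def using nl by (intro flat) simp
    have low: "fA k e \<le> tilted_visits z 0 n e" for e
      using tilted_visits_mono[OF kn, of e] by (simp add: visits_blocks)
    have w: "0 < \<kappa> ^ k * al k" using weight_pos[of k] \<kappa> by simp
    have "C * \<kappa> ^ l * al l \<le> C * \<kappa> ^ k * (R * al k)"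
      using al_Suc_le[of k] \<kappa> C weight_pos[of l] unfolding l
      by (intro mult_mono) (auto intro: mult_left_le_one_le)
    also have "\<dots> = \<epsilon> * (B * \<kappa> ^ k * al k)" using \<epsilon> by (simp add: B_def)
    finally have xB: "x \<le> \<epsilon> * (B * \<kappa> ^ k * al k)" by (simp add: x_def)
    have b: "B * \<kappa> ^ k * al k \<le> tilted_visits z 0 n d" "B * \<kappa> ^ k * al k \<le> tilted_visits z 0 n (d + 1)"
      using K[OF l(2)] low[of d] low[of "d + 1"] by linarith+
    have "x \<le> \<epsilon> * tilted_visits z 0 n d" "x \<le> \<epsilon> * tilted_visits z 0 n (d + 1)"
      using xB b \<epsilon> by (meson mult_left_mono order_trans less_imp_le)+
    moreover have "0 < B * \<kappa> ^ k * al k" using B w by (simp add: mult.assoc)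
    ultimately show ?case
      using nf[unfolded nearly_flat_def, rule_format, of d] b by (simp add: distrib_right)
  qed
qed

lemma ratio_step: "(\<lambda>n. tilted_visits z 0 n (d + 1) / tilted_visits z 0 n d) \<longlonglongrightarrow> 1"
proof (rule tendstoI)
  fix e :: real assume e: "0 < e"
  then have "0 < e / 4" by simp
  from eventually_ratio_close[OF this, of d]
  show "\<forall>\<^sub>F n in sequentially. dist (tilted_visits z 0 n (d + 1) / tilted_visits z 0 n d) 1 < e"
  proof eventually_elim
    case (elim n)
    define a where "a = tilted_visits z 0 n d"
    define b where "b = tilted_visits z 0 n (d + 1)"
    define h where "h = e / 2"
    have h: "0 < h" "h < e" and ab: "0 < a" "b \<le> (1 + h) * a" "a \<le> (1 + h) * b"
      using elim e by (auto simp: a_def b_def h_def)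
    \<comment> \<open>This is 1 / (1 + h) \<ge> 1 - h, kept free of division.\<close>
    have "a * (1 - h) \<le> (1 + h) * b * (1 - h)" if "h < 1"
      using that ab by (intro mult_right_mono) auto
    moreover have "(1 + h) * b * (1 - h) = b - h * h * b" by (simp add: algebra_simps)
    moreover have b0: "0 < b" using ab h by (smt (verit) mult_nonneg_nonpos)
    moreover have "0 \<le> h * h * b" using b0 by simp
    moreover have "a * (1 - h) \<le> 0" if "\<not> h < 1" using that ab by (simp add: mult_nonneg_nonpos)
    ultimately have "a * (1 - h) \<le> b" by (cases "h < 1") linarith+
    then have "\<bar>b / a - 1\<bar> \<le> h" using ab by (simp add: abs_le_iff field_simps)
    then show ?case using h by (simp add: dist_real_def a_def b_def)
  qed
qed

lemma eventually_visits_pos: "\<forall>\<^sub>F n in sequentially. 0 < tilted_visits z 0 n d"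
  using eventually_ratio_close[of 1 d] by (auto elim: eventually_mono)

lemma ratio_limit: "(\<lambda>n. tilted_visits z 0 n d / tilted_visits z 0 n d') \<longlonglongrightarrow> 1"
proof -
  have up: "(\<lambda>n. tilted_visits z 0 n (c + int m) / tilted_visits z 0 n c) \<longlonglongrightarrow> 1" for c m
  proof (induction m)
    case 0
    show ?case
      by (rule tendsto_eventually) (use eventually_visits_pos[of c] in \<open>auto elim: eventually_mono\<close>)
  next
    case (Suc m)
    have "(\<lambda>n. (tilted_visits z 0 n (c + int m + 1) / tilted_visits z 0 n (c + int m)) *
        (tilted_visits z 0 n (c + int m) / tilted_visits z 0 n c)) \<longlonglongrightarrow> 1 * 1"
      by (intro tendsto_mult ratio_step Suc)
    moreover have "\<forall>\<^sub>F n in sequentially.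
        (tilted_visits z 0 n (c + int m + 1) / tilted_visits z 0 n (c + int m)) *
        (tilted_visits z 0 n (c + int m) / tilted_visits z 0 n c)
        = tilted_visits z 0 n (c + int (Suc m)) / tilted_visits z 0 n c"
      using eventually_visits_pos[of "c + int m"] by eventually_elim (simp add: add_ac)
    ultimately have "(\<lambda>n. tilted_visits z 0 n (c + int (Suc m)) / tilted_visits z 0 n c) \<longlonglongrightarrow> 1 * 1"
      by (rule Lim_transform_eventually)
    then show ?case by (simp only: mult_1)
  qed
  show ?thesis
  proof (cases "d' \<le> d")
    case True
    then show ?thesis using up[of d' "nat (d - d')"] by simp
  next
    case False
    then have "(\<lambda>n. tilted_visits z 0 n d' / tilted_visits z 0 n d) \<longlonglongrightarrow> 1"
      using up[of d "nat (d' - d)"] by simp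
    from tendsto_inverse[OF this] show ?thesis by simp
  qed
qed

lemma discrepancy_tilted:
  assumes z: "z = exp (- \<eta> / 2)"
  shows "exponentially_tilted (discrepancy (\<beta> / 2)) \<eta>"
  unfolding exponentially_tilted_def
proof (intro ballI)
  fix \<xi>1 \<xi>2 assume "\<xi>1 \<in> half_ints" "\<xi>2 \<in> half_ints"
  then obtain i j :: int where ij: "\<xi>1 = of_int i / 2" "\<xi>2 = of_int j / 2"
    by (auto simp: half_ints_def)
  have zz: "z powi m = exp (- \<eta> / 2 * of_int m)" for m :: int
    unfolding z by (simp add: exp_power_int mult.commute)
  have "(\<lambda>n. (tilted_visits z 0 n (i - 1) / tilted_visits z 0 n (j - 1)) * exp (\<eta> * (\<xi>1 - \<xi>2)))
      \<longlonglongrightarrow> 1 * exp (\<eta> * (\<xi>1 - \<xi>2))"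
    by (intro tendsto_mult ratio_limit tendsto_const)
  \<comment> \<open>The offset in S = 2 * D - 1 cancels in the quotient, and its scale 2 is the
    reason for the exponent -\<eta> / 2 in z.\<close>
  moreover have E: "z powi (j - 1) / z powi (i - 1) = exp (\<eta> * (\<xi>1 - \<xi>2))"
    unfolding zz ij exp_diff[symmetric] by (simp add: field_simps)
  have "(tilted_visits z 0 n (i - 1) / tilted_visits z 0 n (j - 1)) * exp (\<eta> * (\<xi>1 - \<xi>2))
     = real (visits (discrepancy (\<beta> / 2)) \<xi>1 n) / real (visits (discrepancy (\<beta> / 2)) \<xi>2 n)" for n
    unfolding E[symmetric] unfolding ij visits_half_slope[OF z_pos] by simp
  ultimately show "(\<lambda>n. real (visits (discrepancy (\<beta> / 2)) \<xi>1 n) / real (visits (discrepancy (\<beta> / 2)) \<xi>2 n))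
      \<longlonglongrightarrow> exp (\<eta> * (\<xi>1 - \<xi>2))" by simp
qed

end

theorem theorem1p4:
  fixes \<eta> :: real
  shows "\<exists>\<alpha>::real. \<alpha> \<notin> \<rat> \<and> bounded_type \<alpha> \<and> exponentially_tilted (discrepancy \<alpha>) \<eta>"
proof -
  define z where "z = exp (- \<eta> / 2)"
  interpret tilt z by unfold_locales (simp add: z_def)
  obtain \<beta> :: real where \<beta>: "\<And>k. 0 < block_lengths.sig fl k * (block_lengths.qA fl k * \<beta> - block_lengths.pA fl k) \<and>
      block_lengths.sig fl k * (block_lengths.qB fl k * \<beta> - block_lengths.pB fl k) < 0"
    using block_lengths.slope_exists[of fl] by blast
  interpret tilted_walk z \<beta> by unfold_locales (use \<beta> in auto)
  show ?thesis
    using half_slope_irrational half_slope_bounded_type discrepancy_tilted[OF z_def] by blast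
qed

end
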